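(* Let $n\ge 1$, and let $\mathcal D_n$ be the set of Dyck paths of semilength $n$. (1) Deleting all even entries of $\pi\in\mathfrak D^1_{2n}(132)$ and replacing each remaining entry $j$ by $(j+1)/2$ defines a bijection $f_1:\mathfrak D^1_{2n}(132)\to\mathfrak S_n(132)$; hence $\varphi\circ f_1$ is a bijection $\mathfrak D^1_{2n}(132)\to\mathcal D_n$. (2) Deleting all odd entries of $\pi\in\mathfrak D^1_{2n}(231)$ and replacing each remaining entry $j$ by $j/2$ defines a bijection $f_2:\mathfrak D^1_{2n}(231)\to\mathfrak S_n(231)$; hence $\varphi^R\circ f_2$ is a bijection $\mathfrak D^1_{2n}(231)\to\mathcal D_n$. (3) The map sending $\pi\in\mathfrak D^2_{2n}(321)$ to the path obtained from the Dyck path $\psi(\pi)\in\mathcal D_{2n}$ by replacing every occurrence of $\mathbf{udd}$ (consecutive steps) with a single $\mathbf d$ is a bijection $\mathfrak D^2_{2n}(321)\to\mathcal D_n$.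
   Context: A permutation $\sigma\in\mathfrak S_N$ contains a pattern $\tau\in\mathfrak S_k$ if there are positions $i_1<\dots<i_k$ such that $(\sigma(i_1),\dots,\sigma(i_k))$ is order-isomorphic to $\tau$; otherwise $\sigma$ avoids $\tau$. $\mathfrak S_N(\tau)$ is the set of $\tau$-avoiding permutations in $\mathfrak S_N$. A Dumont permutation of the first kind is a permutation $\pi\in\mathfrak S_{2n}$ such that for every $i=1,\dots,2n$: if $\pi(i)$ is even then $i<2n$ and $\pi(i)>\pi(i+1)$; if $\pi(i)$ is odd then $i=2n$ or $\pi(i)<\pi(i+1)$. A Dumont permutation of the second kind is a permutation $\pi\in\mathfrak S_{2n}$ such that $\pi(2i)<2i$ and $\pi(2i-1)\ge 2i-1$ for $i=1,\dots,n$. $\mathfrak D^1_{2n}(\tau)$ and $\mathfrak D^2_{2n}(\tau)$ denote the sets of $\tau$-avoiding Dumont permutations of length $2n$ of the first and second kind, respectively. A Dyck path of semilength $N$ is a path from $(0,0)$ to $(2N,0)$ with steps $\mathbf u=(1,1)$ and $\mathbf d=(1,-1)$ that never goes below the $x$-axis. The map $\varphi:\mathfrak S_N(132)\to\mathcal D_N$ (Krattenthaler's known bijection): represent $\pi$ by dots in an $N\times N$ board (a dot in column $i$ from the left and row $\pi(i)$ from the bottom), and take the lattice path with west and north unit steps from $(N,0)$ to $(0,N)$, not above the antidiagonal $y=N-x$, that leaves all dots to its right and stays as close to the antidiagonal as possible (explicitly, its west step across column $i$ is at height $\min(\pi(1),\dots,\pi(i))-1$); read $\mathbf u$ for each west step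 and $\mathbf d$ for each north step. The bijection $\varphi^R:\mathfrak S_N(231)\to\mathcal D_N$ is $\varphi$ applied to the reversal $\pi_N\cdots\pi_2\pi_1$ of $\pi$. The map $\psi:\mathfrak S_N(321)\to\mathcal D_N$ (a known bijection): in the same board, take the path with north and east unit steps from $(0,0)$ to $(N,N)$ that leaves all dots to its right and stays as close to the diagonal as possible (explicitly, its east step across column $i$ is at height $\max(\pi(1),\dots,\pi(i))$); read $\mathbf u$ for each north step and $\mathbf d$ for each east step. *)

theory Defs
  imports "HOL-Combinatorics.Multiset_Permutations"
begin

text \<open>
  A permutation of \<open>{1..N}\<close> is the list of its values (one-line notation); the set of all of
  them is the library's \<^term>\<open>permutations_of_set {1..N}\<close>. Positions are counted from 1, as
  usual for permutations: \<open>entry \<pi> i\<close> is \<open>\<pi>(i)\<close> for \<open>1 \<le> i \<le> length \<pi>\<close>.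
\<close>

definition entry :: "nat list \<Rightarrow> nat \<Rightarrow> nat" where
  "entry \<pi> i = \<pi> ! (i - 1)"

definition contains_pattern :: "nat list \<Rightarrow> nat list \<Rightarrow> bool" where
  "contains_pattern \<sigma> \<tau> \<longleftrightarrow>
     (\<exists>p :: nat \<Rightarrow> nat.
        strict_mono_on {1..length \<tau>} p \<and> p ` {1..length \<tau>} \<subseteq> {1..length \<sigma>} \<and>
        (\<forall>a\<in>{1..length \<tau>}. \<forall>b\<in>{1..length \<tau>}.
           entry \<sigma> (p a) < entry \<sigma> (p b) \<longleftrightarrow> entry \<tau> a < entry \<tau> b))"

definition avoiders :: "nat \<Rightarrow> nat list \<Rightarrow> nat list set" where
  "avoiders N \<tau> = {\<sigma> \<in> permutations_of_set {1..N}. \<not> contains_pattern \<sigma> \<tau>}"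

text \<open>The argument \<open>n\<close> of the next two predicates is half of the length.\<close>

definition dumont1 :: "nat \<Rightarrow> nat list \<Rightarrow> bool" where
  "dumont1 n \<pi> \<longleftrightarrow>
     \<pi> \<in> permutations_of_set {1..2 * n} \<and>
     (\<forall>i\<in>{1..2 * n}.
        (even (entry \<pi> i) \<longrightarrow> i < 2 * n \<and> entry \<pi> i > entry \<pi> (i + 1)) \<and>
        (odd (entry \<pi> i) \<longrightarrow> i = 2 * n \<or> entry \<pi> i < entry \<pi> (i + 1)))"

definition dumont2 :: "nat \<Rightarrow> nat list \<Rightarrow> bool" where
  "dumont2 n \<pi> \<longleftrightarrow>
     \<pi> \<in> permutations_of_set {1..2 * n} \<and>
     (\<forall>i\<in>{1..n}. entry \<pi> (2 * i) < 2 * i \<and> entry \<pi> (2 * i - 1) \<ge> 2 * i - 1)"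

definition dumont1_avoiders :: "nat \<Rightarrow> nat list \<Rightarrow> nat list set" where
  "dumont1_avoiders n \<tau> = {\<pi>. dumont1 n \<pi> \<and> \<not> contains_pattern \<pi> \<tau>}"

definition dumont2_avoiders :: "nat \<Rightarrow> nat list \<Rightarrow> nat list set" where
  "dumont2_avoiders n \<tau> = {\<pi>. dumont2 n \<pi> \<and> \<not> contains_pattern \<pi> \<tau>}"

datatype step = Up | Down

fun step_value :: "step \<Rightarrow> int" where
  "step_value Up = 1"
| "step_value Down = - 1"

text \<open>A path from the origin is its word of steps; \<open>height w\<close> is the ordinate of its end point.\<close>

definition height :: "step list \<Rightarrow> int" where
  "height w = sum_list (map step_value w)"

definition dyck_paths :: "nat \<Rightarrow> step list set" where
  "dyck_paths N =
     {w. length w = 2 * N \<and> height w = 0 \<and> (\<forall>k\<le>length w. height (take k w) \<ge> 0)}"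

text \<open>
  The path \<open>\<phi>(\<pi>)\<close> runs from \<open>(N, 0)\<close> to \<open>(0, N)\<close>, so it crosses the columns in the order
  \<open>N, N - 1, \<dots>, 1\<close>. It reaches column \<open>i\<close> at height \<open>west_height \<pi> (i + 1)\<close> (at height 0 if
  \<open>i = N\<close>), climbs to \<open>west_height \<pi> i\<close> and crosses the column there; after column 1 it
  climbs to height \<open>N\<close>. West steps are read as \<open>Up\<close>, north steps as \<open>Down\<close>. The differences
  of natural numbers below are never truncated when \<open>\<pi>\<close> is a permutation of \<open>{1..N}\<close> with
  \<open>N \<ge> 1\<close>, since the heights weakly increase along the path.
\<close>

definition west_height :: "nat list \<Rightarrow> nat \<Rightarrow> nat" where
  "west_height \<pi> i = Min (set (take i \<pi>)) - 1"

definition phi :: "nat list \<Rightarrow> step list" where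
  "phi \<pi> =
     (let N = length \<pi> in
        concat (map (\<lambda>i. replicate (west_height \<pi> i -
                                    (if i = N then 0 else west_height \<pi> (i + 1))) Down @ [Up])
                    (rev [1..<N + 1]))
        @ replicate (N - west_height \<pi> 1) Down)"

definition phi_R :: "nat list \<Rightarrow> step list" where
  "phi_R \<pi> = phi (rev \<pi>)"

text \<open>
  The path \<open>\<psi>(\<pi>)\<close> runs from \<open>(0, 0)\<close> to \<open>(N, N)\<close> and crosses column \<open>i\<close> at height
  \<open>east_height \<pi> i\<close>; the value at \<open>i = 0\<close> is the starting height 0. North steps are read as
  \<open>Up\<close>, east steps as \<open>Down\<close>. No north steps remain after column \<open>N\<close>, as
  \<open>east_height \<pi> N = N\<close> for a permutation \<open>\<pi>\<close> of \<open>{1..N}\<close>.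
\<close>

definition east_height :: "nat list \<Rightarrow> nat \<Rightarrow> nat" where
  "east_height \<pi> i = (if i = 0 then 0 else Max (set (take i \<pi>)))"

definition psi :: "nat list \<Rightarrow> step list" where
  "psi \<pi> =
     concat (map (\<lambda>i. replicate (east_height \<pi> i - east_height \<pi> (i - 1)) Up @ [Down])
                 [1..<length \<pi> + 1])"

definition f1 :: "nat list \<Rightarrow> nat list" where
  "f1 \<pi> = map (\<lambda>j. (j + 1) div 2) (filter odd \<pi>)"

definition f2 :: "nat list \<Rightarrow> nat list" where
  "f2 \<pi> = map (\<lambda>j. j div 2) (filter even \<pi>)"

text \<open>
  Two occurrences of \<open>Up Down Down\<close> in a word never overlap, so a single scan from left to
  right replaces all occurrences in the original word, and the inserted \<open>Down\<close> is not
  scanned again.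
\<close>

fun replace_udd :: "step list \<Rightarrow> step list" where
  "replace_udd (Up # Down # Down # w) = Down # replace_udd w"
| "replace_udd (x # w) = x # replace_udd w"
| "replace_udd [] = []"

end

(*
Parts (1) and (2): binary trees with n nodes parametrize every class at once. Splitting at the
largest entry, a 132-avoiding permutation is L n R with L > R; a 132-avoiding Dumont permutation
of the first kind is L (2n-1) (2n) R with L > R and L, R again Dumont of even length and R
nonempty, or 2n L (2n-1); a 231-avoiding one is R (2n) L (2n-1) with R < L. Under f1, f2 and phi
these decompositions turn into one another and into the decomposition r u l d of a Dyck path, so
each map is a bijection as soon as its composite with the parametrization is one.

Part (3): in a 321-avoiding Dumont permutation of the second kind the left-to-right maxima are
exactly the entries in odd positions, so psi has the form u^a1 dd u^a2 dd ..., and replacing udd by d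
gives a path with one letter for each value: the k-th letter is d if and only if the value k is a
left-to-right maximum. Conversely a Dyck path w gives the permutation whose odd positions carry the
positions of the letters d of w in increasing order, and whose even positions carry those of the
letters u.
*)

theory Submission
  imports Defs "HOL-Library.Sublist"
begin

section \<open>Patterns of length three\<close>

text \<open>If \<open>g\<close> agrees at \<open>h s\<close> and \<open>h t\<close>, then
  \<open>y s = y t\<close>, so \<open>s = t\<close>. Hence for each class of permutations it is
  enough to show that its parametrization is onto and to compute the composite with the map in
  question.\<close>

lemma bij_betw_via_parametrization:
  assumes "bij_betw y T B" "h ` T = A" "\<And>t. t \<in> T \<Longrightarrow> g (h t) = y t"
  shows "bij_betw g A B"
proof -
  have "inj_on g A" 
    using assms by (auto simp: bij_betw_def inj_on_def)
  moreover have "g ` A = y ` T" using assms by (force simp: image_image)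
  ultimately show ?thesis using assms(1) by (simp add: bij_betw_def)
qed

lemma subseq_Cons_iff_nth:
  "subseq (a # as) xs \<longleftrightarrow> (\<exists>i<length xs. xs ! i = a \<and> subseq as (drop (Suc i) xs))"
proof
  assume "subseq (a # as) xs"
  then obtain us v vs where "xs = us @ v # vs" "v = a" "subseq as vs"
    by (auto dest: list_emb_ConsD)
  then show "\<exists>i<length xs. xs ! i = a \<and> subseq as (drop (Suc i) xs)"
    by (intro exI[of _ "length us"]) auto
next
  assume "\<exists>i<length xs. xs ! i = a \<and> subseq as (drop (Suc i) xs)"
  then obtain i where i: "i < length xs" "xs ! i = a" "subseq as (drop (Suc i) xs)" by blast
  then have "subseq (a # as) (drop i xs)" by (simp add: Cons_nth_drop_Suc[symmetric])
  then show "subseq (a # as) xs"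
    by (metis append_take_drop_id list_emb_append2)
qed

text \<open>The two views of a triple serve different ends: subsequences pass through concatenations
  and sublists, while indices connect to \<open>contains_pattern\<close> and to reversal.\<close>

lemma subseq3_iff_nth:
  "subseq [a, b, c] xs \<longleftrightarrow>
     (\<exists>i j k. i < j \<and> j < k \<and> k < length xs \<and> xs ! i = a \<and> xs ! j = b \<and> xs ! k = c)"
    (is "?L \<longleftrightarrow> ?R")
proof
  assume ?L
  then obtain i j k where "i < length xs" "xs ! i = a" "j < length xs - Suc i"
      "xs ! (Suc i + j) = b" "k < length xs - Suc (Suc (i + j))" "xs ! (Suc (Suc (i + j)) + k) = c"
    by (auto simp: subseq_Cons_iff_nth add.commute add.left_commute)
  then show ?R
    by (intro exI[of _ i] exI[of _ "Suc i + j"] exI[of _ "Suc (Suc (i + j)) + k"]) auto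
next
  assume ?R
  then obtain i j k where "i < j" "j < k" "k < length xs" "xs ! i = a" "xs ! j = b" "xs ! k = c"
    by blast
  moreover from this have "subseq [c] (drop (Suc j) xs)"
    unfolding subseq_Cons_iff_nth by (intro exI[of _ "k - Suc j"]) auto
  moreover from calculation have "subseq [b, c] (drop (Suc i) xs)"
    unfolding subseq_Cons_iff_nth[of b] by (intro exI[of _ "j - Suc i"]) auto
  ultimately show ?L
    unfolding subseq_Cons_iff_nth[of a] by (intro exI[of _ i]) auto
qed

lemma atLeastAtMost_1_3: "{1..length [x, y, z]} = {1, 2, 3::nat}"
  by auto

text \<open>Each value is paired with its pattern letter, so order isomorphism becomes a condition
  over an explicit finite set of pairs, which simplification expands once the letters are
  numerals.\<close>

lemma contains_pattern_3:
  "contains_pattern \<sigma> [x, y, z] \<longleftrightarrow>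
     (\<exists>i j k. i < j \<and> j < k \<and> k < length \<sigma> \<and>
        (\<forall>(s, t)\<in>{(\<sigma> ! i, x), (\<sigma> ! j, y), (\<sigma> ! k, z)}.
         \<forall>(s', t')\<in>{(\<sigma> ! i, x), (\<sigma> ! j, y), (\<sigma> ! k, z)}. s < s' \<longleftrightarrow> t < t'))" (is "?L \<longleftrightarrow> ?R")
proof
  assume ?L
  then obtain p where p: "strict_mono_on {1, 2, 3} p" "p ` {1, 2, 3} \<subseteq> {1..length \<sigma>}"
    and iso: "\<And>a b. a \<in> {1, 2, 3} \<Longrightarrow> b \<in> {1, 2, 3} \<Longrightarrow> entry \<sigma> (p a) < entry \<sigma> (p b) \<longleftrightarrow>
        entry [x, y, z] a < entry [x, y, z] b"
    unfolding contains_pattern_def atLeastAtMost_1_3 by blast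
  define i j k where "i = p 1 - 1" and "j = p 2 - 1" and "k = p 3 - 1"
  note ijk = this
  have less: "p 1 < p 2" "p 2 < p 3" and range: "1 \<le> p 1" "p 3 \<le> length \<sigma>"
    using p by (auto simp: strict_mono_on_def)
  then have "i < j" "j < k" "k < length \<sigma>" unfolding ijk by linarith+
  moreover have "\<forall>(s, t)\<in>{(\<sigma> ! i, x), (\<sigma> ! j, y), (\<sigma> ! k, z)}.
         \<forall>(s', t')\<in>{(\<sigma> ! i, x), (\<sigma> ! j, y), (\<sigma> ! k, z)}. s < s' \<longleftrightarrow> t < t'"
    using iso[of 1 2] iso[of 1 3] iso[of 2 1] iso[of 2 3] iso[of 3 1] iso[of 3 2]
    by (simp add: entry_def ijk)
  ultimately show ?R by blast
next
  assume ?R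
  then obtain i j k where ijk: "i < j" "j < k" "k < length \<sigma>"
    and iso: "\<forall>(s, t)\<in>{(\<sigma> ! i, x), (\<sigma> ! j, y), (\<sigma> ! k, z)}.
         \<forall>(s', t')\<in>{(\<sigma> ! i, x), (\<sigma> ! j, y), (\<sigma> ! k, z)}. s < s' \<longleftrightarrow> t < t'" by blast
  \<comment> \<open>Positions count from 1 and list indices from 0, hence the shift by one.\<close>
  define p :: "nat \<Rightarrow> nat" where "p a = (if a = 1 then i + 1 else if a = 2 then j + 1 else k + 1)" for a
  have "strict_mono_on {1, 2, 3} p" using ijk by (auto simp: strict_mono_on_def p_def)
  moreover have "p ` {1, 2, 3} \<subseteq> {1..length \<sigma>}" using ijk by (auto simp: p_def)
  moreover have "\<forall>a\<in>{1, 2, 3}. \<forall>b\<in>{1, 2, 3}. entry \<sigma> (p a) < entry \<sigma> (p b) \<longleftrightarrow>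
        entry [x, y, z] a < entry [x, y, z] b"
    using iso by (simp add: p_def entry_def)
  ultimately show ?L
    unfolding contains_pattern_def atLeastAtMost_1_3 by blast
qed

lemma contains_pattern_3_subseq:
  "contains_pattern \<sigma> [x, y, z] \<longleftrightarrow>
     (\<exists>a b c. subseq [a, b, c] \<sigma> \<and>
        (\<forall>(s, t)\<in>{(a, x), (b, y), (c, z)}. \<forall>(s', t')\<in>{(a, x), (b, y), (c, z)}. s < s' \<longleftrightarrow> t < t'))"
  unfolding contains_pattern_3 subseq3_iff_nth by blast

lemma contains_132: "contains_pattern \<sigma> [1, 3, 2] \<longleftrightarrow> (\<exists>a b c. subseq [a, b, c] \<sigma> \<and> a < c \<and> c < b)"
  unfolding contains_pattern_3_subseq by (intro ex_cong1) auto

lemma subseq3_revI: "subseq [a, b, c] xs \<Longrightarrow> subseq [c, b, a] (rev xs)"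
  unfolding subseq3_iff_nth
proof (elim exE conjE)
  fix i j k assume "i < j" "j < k" "k < length xs" "xs ! i = a" "xs ! j = b" "xs ! k = c"
  then show "\<exists>i j k. i < j \<and> j < k \<and> k < length (rev xs) \<and> rev xs ! i = c \<and> rev xs ! j = b \<and> rev xs ! k = a"
    by (intro exI[of _ "length xs - Suc k"] exI[of _ "length xs - Suc j"] exI[of _ "length xs - Suc i"])
       (simp add: rev_nth diff_less_mono2)
qed

text \<open>Reading backwards turns 2 3 1 into 1 3 2, so the structure theory for 132 also serves
  the classes that avoid 231.\<close>

lemma contains_231: "contains_pattern \<sigma> [2, 3, 1] \<longleftrightarrow> contains_pattern (rev \<sigma>) [1, 3, 2]"
proof -
  have "contains_pattern \<sigma> [2, 3, 1] \<longleftrightarrow> (\<exists>c b a. subseq [c, b, a] \<sigma> \<and> a < c \<and> c < b)"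
    unfolding contains_pattern_3_subseq by (intro ex_cong1) auto
  also have "\<dots> \<longleftrightarrow> (\<exists>a b c. subseq [a, b, c] (rev \<sigma>) \<and> a < c \<and> c < b)"
    using subseq3_revI[of _ _ _ \<sigma>] subseq3_revI[of _ _ _ "rev \<sigma>"] by (metis rev_rev_ident)
  finally show ?thesis unfolding contains_132 .
qed

lemma contains_321: "contains_pattern \<sigma> [3, 2, 1] \<longleftrightarrow>
    (\<exists>i j k. i < j \<and> j < k \<and> k < length \<sigma> \<and> \<sigma> ! k < \<sigma> ! j \<and> \<sigma> ! j < \<sigma> ! i)"
  unfolding contains_pattern_3 by (intro ex_cong1) auto

section \<open>Words avoiding 132 and their blocks around the maximum\<close>

definition avoids132 :: "nat list \<Rightarrow> bool" where
  "avoids132 xs \<longleftrightarrow> \<not> contains_pattern xs [1, 3, 2]"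

lemma avoids132_iff: "avoids132 xs \<longleftrightarrow> (\<forall>a b c. subseq [a, b, c] xs \<longrightarrow> a < c \<longrightarrow> b \<le> c)"
  unfolding avoids132_def contains_132 by (meson not_le)

lemma avoids132_Nil [simp]: "avoids132 []"
  by (simp add: avoids132_iff)

lemma avoids132_single [simp]: "avoids132 [x]"
  by (auto simp: avoids132_iff subseq3_iff_nth)

lemma avoids132_subseq: "avoids132 xs \<Longrightarrow> subseq ys xs \<Longrightarrow> avoids132 ys"
  unfolding avoids132_iff using subseq_order.trans by blast

lemma avoids132_map_add [simp]: "avoids132 (map (\<lambda>x. x + k) xs) \<longleftrightarrow> avoids132 xs"
proof -
  have "contains_pattern (map (\<lambda>x. x + k) xs) [1, 3, 2] \<longleftrightarrow> contains_pattern xs [1, 3, 2]"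
    unfolding contains_pattern_3 by (intro ex_cong1) auto
  then show ?thesis by (simp add: avoids132_def)
qed

text \<open>An occurrence that straddles the cut has its first letter in \<open>xs\<close> and its
  last in \<open>ys\<close>, so the last is below the first, contrary to the pattern.\<close>

lemma avoids132_append:
  assumes "avoids132 xs" "avoids132 ys" "\<And>x y. x \<in> set xs \<Longrightarrow> y \<in> set ys \<Longrightarrow> y < x"
  shows "avoids132 (xs @ ys)"
  unfolding avoids132_iff
proof (intro allI impI)
  fix a b c assume *: "subseq [a, b, c] (xs @ ys)" "a < c"
  then obtain us vs where uv: "[a, b, c] = us @ vs" "subseq us xs" "subseq vs ys"
    by (auto simp: subseq_append_iff)
  have sub: "set us \<subseteq> set xs" "set vs \<subseteq> set ys"
    using uv(2,3) by (auto elim: list_emb_set)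
  consider "us = []" | "vs = []" | "a \<in> set us" "c \<in> set vs"
    using uv(1) by (cases us; cases vs rule: rev_cases) auto
  then show "b \<le> c"
  proof cases
    case 3
    then have "c < a" using assms(3) sub by blast
    then show ?thesis using \<open>a < c\<close> by simp
  qed (use uv assms(1,2) \<open>a < c\<close> in \<open>auto simp: avoids132_iff\<close>)
qed

text \<open>The new final entry could only be the last letter of an occurrence, but it is at least
  as large as any middle letter.\<close>

lemma avoids132_snoc:
  assumes "avoids132 xs" "\<And>x. x \<in> set xs \<Longrightarrow> x \<le> y"
  shows "avoids132 (xs @ [y])"
  unfolding avoids132_iff
proof (intro allI impI)
  fix a b c assume *: "subseq [a, b, c] (xs @ [y])" "a < c"
  then obtain i j k where ijk: "i < j" "j < k" "k < Suc (length xs)"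
    "(xs @ [y]) ! i = a" "(xs @ [y]) ! j = b" "(xs @ [y]) ! k = c" by (auto simp: subseq3_iff_nth)
  show "b \<le> c"
  proof (cases "k = length xs")
    case True
    then show ?thesis using ijk assms(2)[of b] by (auto simp: nth_append)
  next
    case False
    then have "subseq [a, b, c] xs" unfolding subseq3_iff_nth using ijk
      by (intro exI[of _ i] exI[of _ j] exI[of _ k]) (auto simp: nth_append)
    then show ?thesis using assms(1) \<open>a < c\<close> by (auto simp: avoids132_iff)
  qed
qed

text \<open>Otherwise \<open>x\<close>, \<open>z\<close>, \<open>y\<close> would form the pattern,
  with \<open>z\<close> above both.\<close>

lemma avoids132_around:
  assumes "avoids132 (xs @ z # ys)" "\<And>x. x \<in> set xs \<Longrightarrow> x < z" "\<And>y. y \<in> set ys \<Longrightarrow> y < z"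
    and "x \<in> set xs" "y \<in> set ys"
  shows "y \<le> x"
proof -
  have "subseq ([x] @ [z] @ [y]) (xs @ [z] @ ys)"
    using assms by (intro list_emb_append_mono) (auto simp: subseq_singleton_left)
  then have "subseq [x, z, y] (xs @ z # ys)" by simp
  then show ?thesis using assms(1) assms(3)[OF assms(5)] unfolding avoids132_iff
    by (meson not_le)
qed

text \<open>With \<open>b\<close> in \<open>B\<close>, every smaller positive number is in
  \<open>B\<close> too, since elements of \<open>A\<close> exceed \<open>b\<close>. So
  \<open>B\<close> is an initial segment and is determined by its cardinality.\<close>

lemma disjoint_below_intervals:
  fixes A B :: "nat set"
  assumes "A \<union> B = {1..m}" "\<And>a b. a \<in> A \<Longrightarrow> b \<in> B \<Longrightarrow> b < a"
  shows "B = {1..card B}" "A = {card B + 1..m}"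
proof -
  have fin: "finite A" "finite B" using assms(1) by (metis finite_Un finite_atLeastAtMost)+
  have sub: "B \<subseteq> {1..m}" "A \<subseteq> {1..m}" using assms(1) by auto
  have down: "{1..b} \<subseteq> B" if "b \<in> B" for b
  proof
    fix x assume x: "x \<in> {1..b}"
    then have "x \<in> A \<union> B" using assms(1) that sub by auto
    then show "x \<in> B" using assms(2)[OF _ that] x by force
  qed
  show B: "B = {1..card B}"
  proof (cases "B = {}")
    case False
    then have "Max B \<in> B" using fin by simp
    then have "B \<subseteq> {1..Max B}" "{1..Max B} \<subseteq> B" using down sub fin by auto
    then have "B = {1..Max B}" by blast
    then show ?thesis by (metis card_atLeastAtMost diff_Suc_1)
  qed simp
  have "A \<inter> B = {}" using assms(2) by blast
  then have "A = {1..m} - B" using assms(1) by blast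
  also have "\<dots> = {1..m} - {1..card B}" using B by simp
  finally show "A = {card B + 1..m}" by auto
qed

lemma permutations_of_set_split_at:
  assumes "xs \<in> permutations_of_set S" "m \<in> S"
  obtains ys zs where "xs = ys @ m # zs" "set ys \<union> set zs = S - {m}"
    "distinct ys" "distinct zs" "set ys \<inter> set zs = {}"
proof -
  have "m \<in> set xs" using assms by (auto simp: permutations_of_set_def)
  then obtain ys zs where "xs = ys @ m # zs" by (meson split_list)
  then show ?thesis using assms that by (auto simp: permutations_of_set_def)
qed

lemma map_add_diff: "(\<And>x. x \<in> set xs \<Longrightarrow> k \<le> x) \<Longrightarrow> map (\<lambda>x. x + k) (map (\<lambda>x. x - k) xs) = (xs :: nat list)"
  by (simp add: map_idI)

text \<open>The upper block of a decomposition carries the values above \<open>k\<close>; lowering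
  them makes an induction hypothesis applicable.\<close>

lemma permutation_shift_down:
  assumes "set xs = {k + 1..k + m}" "distinct xs"
  obtains ys :: "nat list" where "xs = map (\<lambda>x. x + k) ys" "ys \<in> permutations_of_set {1..m}"
proof -
  let ?ys = "map (\<lambda>x. x - k) xs"
  have eq: "xs = map (\<lambda>x. x + k) ?ys"
    using assms by (intro map_add_diff[symmetric]) auto
  have "(\<lambda>x. x + k) ` set ?ys = (\<lambda>x. x + k) ` {1..m}"
    using eq assms by (metis image_add_atLeastAtMost' list.set_map add.commute)
  moreover have "inj (\<lambda>x. x + k)" by (auto simp: inj_def)
  ultimately have "set ?ys = {1..m}" by (metis inj_image_eq_iff)
  moreover have "distinct ?ys" using eq assms by (metis distinct_map)
  ultimately have "?ys \<in> permutations_of_set {1..m}" by (simp add: permutations_of_set_def)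
  then show ?thesis using that eq by blast
qed

section \<open>Binary trees, Dyck paths and 132-avoiding permutations\<close>

datatype btree = Leaf | Node btree btree

text \<open>Decomposition at the last return: the left subtree lies under the final arch and the
  right subtree precedes it. The right subtree is written first because \<open>phi\<close> crosses
  the columns from right to left.\<close>

fun dyck_word :: "btree \<Rightarrow> step list" where
  "dyck_word Leaf = []"
| "dyck_word (Node l r) = dyck_word r @ Up # dyck_word l @ [Down]"

fun perm132 :: "btree \<Rightarrow> nat list" where
  "perm132 Leaf = []"
| "perm132 (Node l r) =
     map (\<lambda>x. x + size r) (perm132 l) @ (size l + size r + 1) # perm132 r"

lemma height_simps [simp]:
  "height [] = 0" "height (s # w) = step_value s + height w" "height (v @ w) = height v + height w"
  by (simp_all add: height_def)

lemma length_dyck_word [simp]: "length (dyck_word t) = 2 * size t"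
  by (induction t) auto

lemma dyck_word_height:
  "height (dyck_word t) = 0" "k \<le> length (dyck_word t) \<Longrightarrow> height (take k (dyck_word t)) \<ge> 0"
proof (induction t arbitrary: k)
  case (Node l r)
  {
    case 1 show ?case using Node.IH by simp
  next
    case 2
    \<comment> \<open>The number of steps that the prefix takes beyond the \<open>Up\<close> opening
      the final arch.\<close>
    define m where "m = k - 2 * size r - 1"
    show ?case using Node.IH(1) Node.IH(2)[of m] Node.IH(3) Node.IH(4)[of k] 2
      by (auto simp: take_Cons' m_def)
  }
qed auto

lemma dyck_word_in_dyck_paths: "dyck_word t \<in> dyck_paths (size t)"
  using dyck_word_height by (simp add: dyck_paths_def)

text \<open>If \<open>dyck_word r'\<close> were longer, it would end inside the final arch of the
  other decomposition, at height at least one, whereas its height is zero. Used in both directions,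
  this makes the decomposition unique.\<close>

lemma dyck_word_append_eq_lengthD:
  assumes "dyck_word r @ Up # dyck_word l @ [Down] = dyck_word r' @ Up # dyck_word l' @ [Down]"
  shows "length (dyck_word r') \<le> length (dyck_word r)"
proof (rule ccontr)
  let ?w = "dyck_word r @ Up # dyck_word l @ [Down]"
  assume "\<not> ?thesis"
  then have less: "length (dyck_word r) < length (dyck_word r')" by simp
  have len: "length (dyck_word r') \<le> length (dyck_word r) + 1 + length (dyck_word l)"
    using arg_cong[OF assms, of length] by simp
  define k where "k = length (dyck_word r') - length (dyck_word r) - 1"
  have "dyck_word r' = take (length (dyck_word r')) ?w" unfolding assms by simp
  also have "\<dots> = dyck_word r @ Up # take k (dyck_word l)"
    using less len by (auto simp: take_Cons' k_def)
  finally have "height (dyck_word r') = height (dyck_word r @ Up # take k (dyck_word l))"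
    by simp
  moreover have "k \<le> length (dyck_word l)" using len by (simp add: k_def)
  ultimately show False using dyck_word_height(1)[of r] dyck_word_height(1)[of r'] dyck_word_height(2)[of k l]
    by simp
qed

lemma dyck_word_inject: "dyck_word s = dyck_word t \<Longrightarrow> s = t"
proof (induction s arbitrary: t)
  case Leaf
  then show ?case by (cases t) auto
next
  case (Node l r)
  from Node.prems obtain l' r' where t: "t = Node l' r'" by (cases t) auto
  have eq: "dyck_word r @ Up # dyck_word l @ [Down] = dyck_word r' @ Up # dyck_word l' @ [Down]"
    using Node.prems t by simp
  then have "length (dyck_word r) = length (dyck_word r')"
    using dyck_word_append_eq_lengthD[OF eq] dyck_word_append_eq_lengthD[OF eq[symmetric]] by simp
  then have "dyck_word r = dyck_word r'" "dyck_word l = dyck_word l'" using eq by auto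
  then show ?case using Node.IH t by auto
qed

lemma dyck_word_surj: "w \<in> dyck_paths n \<Longrightarrow> \<exists>t. size t = n \<and> dyck_word t = w"
proof (induction n arbitrary: w rule: less_induct)
  case (less n)
  have w: "length w = 2 * n" "height w = 0" "\<And>k. k \<le> 2 * n \<Longrightarrow> height (take k w) \<ge> 0"
    using less.prems by (auto simp: dyck_paths_def)
  show ?case
  proof (cases "n = 0")
    case True
    then show ?thesis using w by (intro exI[of _ Leaf]) auto
  next
    case False
    \<comment> \<open>The last visit to the axis before the end: beyond it the path stays strictly
      positive until its end, so the rest of the word is one arch.\<close>
    define K where "K = {k. k < 2 * n \<and> height (take k w) = 0}"
    have K: "finite K" "0 \<in> K" using False by (auto simp: K_def)
    define k where "k = Max K"
    have "k \<in> K" unfolding k_def using K by (intro Max_in) auto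
    then have k: "k < 2 * n" "height (take k w) = 0" by (auto simp: K_def)
    have after_k: "height (take j w) > 0" if "k < j" "j < 2 * n" for j
    proof -
      have "j \<notin> K" using that K unfolding k_def by (metis Max_ge not_le)
      then show ?thesis using that w(3)[of j] by (auto simp: K_def)
    qed
    define a where "a = take k w"
    obtain s v where sv: "drop k w = s # v" using k w(1) by (cases "drop k w") auto
    then have w_eq: "w = a @ s # v" unfolding a_def by (metis append_take_drop_id)
    have len_a: "length a = k" using k w(1) by (simp add: a_def)
    have ha: "height a = 0" using k by (simp add: a_def)
    have pre: "height (take (k + j) w) = height (take j (s # v))" for j
      using ha len_a by (simp add: w_eq)
    have "height (s # v) = 0" using w(2) ha w_eq by simp
    have s: "s = Up" using pre[of 1] w(3)[of "k + 1"] k by (cases s) auto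
    have "v \<noteq> []" using \<open>height (s # v) = 0\<close> s by auto
    then obtain b e where be: "v = b @ [e]" by (cases v rule: rev_cases) auto
    have lw: "2 * n = k + length b + 2" using w(1) len_a w_eq be by simp
    \<comment> \<open>Inside the arch the path has height at least one, and the opening
      \<open>Up\<close> accounts for exactly one.\<close>
    have hb: "height (take j b) \<ge> 0" if "j \<le> length b" for j
      using after_k[of "k + (j + 1)"] pre[of "j + 1"] that be s lw by simp
    have e: "e = Down" "height b = 0"
      using hb[of "length b"] \<open>height (s # v) = 0\<close> s be by (cases e; simp)+
    have ha': "height (take j a) \<ge> 0" for j
      using w(3)[of "min j k"] k by (simp add: a_def min.commute)
    \<comment> \<open>Each step flips the parity of the height, so a word of height zero has even
      length and thus a semilength.\<close>
    have even_len: "even (length u)" if "height u = 0" for u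
    proof -
      have "even (height u) \<longleftrightarrow> even (length u)" for u
      proof (induction u)
        case (Cons x u) then show ?case by (cases x) auto
      qed simp
      then show ?thesis using that by (metis even_zero)
    qed
    obtain p q where pq: "length a = 2 * p" "length b = 2 * q" 
      using even_len[OF ha] even_len[OF e(2)] by (auto elim!: evenE)
    have npq: "n = p + q + 1" using lw len_a pq by simp
    have "a \<in> dyck_paths p" using ha ha' pq by (simp add: dyck_paths_def)
    moreover have "b \<in> dyck_paths q" using hb e pq by (simp add: dyck_paths_def)
    ultimately obtain l r where "size r = p" "dyck_word r = a" "size l = q" "dyck_word l = b"
      using less.IH[of p a] less.IH[of q b] npq by auto
    then show ?thesis using npq w_eq s be e by (intro exI[of _ "Node l r"]) auto
  qed
qed

lemma bij_betw_dyck_word: "bij_betw dyck_word {t. size t = n} (dyck_paths n)"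
  unfolding bij_betw_def
proof
  show "inj_on dyck_word {t. size t = n}" using dyck_word_inject by (auto intro: inj_onI)
  show "dyck_word ` {t. size t = n} = dyck_paths n"
    using dyck_word_in_dyck_paths dyck_word_surj by (fastforce simp: image_iff)
qed

section \<open>Trees and 132-avoiding permutations\<close>

lemma permutations_of_set_interval_iff:
  "xs \<in> permutations_of_set {1..n} \<longleftrightarrow> set xs = {1..n} \<and> distinct xs"
  by (auto simp: permutations_of_set_def)

lemma length_permutation: "xs \<in> permutations_of_set {1..n} \<Longrightarrow> length xs = n"
  by (metis card_atLeastAtMost diff_Suc_1 length_finite_permutations_of_set)

lemma set_map_add_atLeastAtMost: "set xs = {1..m} \<Longrightarrow> set (map (\<lambda>x. x + k) xs) = {k + 1..k + m::nat}"
  by (simp add: add.commute image_add_atLeastAtMost')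

lemma avoiders_132_iff:
  "xs \<in> avoiders n [1, 3, 2] \<longleftrightarrow> set xs = {1..n} \<and> distinct xs \<and> avoids132 xs"
  by (auto simp: avoiders_def avoids132_def permutations_of_set_def)

lemma perm132_avoider: "perm132 t \<in> avoiders (size t) [1, 3, 2]"
proof (induction t)
  case Leaf
  show ?case by (simp add: avoiders_132_iff del: One_nat_def)
next
  case (Node l r)
  let ?L = "map (\<lambda>x. x + size r) (perm132 l)" and ?n = "size l + size r + 1"
  have lr: "set (perm132 l) = {1..size l}" "distinct (perm132 l)" "avoids132 (perm132 l)"
    "set (perm132 r) = {1..size r}" "distinct (perm132 r)" "avoids132 (perm132 r)"
    using Node.IH unfolding avoiders_132_iff by blast+
  have L: "set ?L = {size r + 1..size r + size l}"
    using lr(1) by (rule set_map_add_atLeastAtMost)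
  have "avoids132 (?L @ [?n])"
  proof (rule avoids132_snoc)
    show "x \<le> ?n" if "x \<in> set ?L" for x using that unfolding L by simp
  qed (use lr in simp)
  then have "avoids132 ((?L @ [?n]) @ perm132 r)"
  proof (rule avoids132_append)
    show "y < x" if "x \<in> set (?L @ [?n])" "y \<in> set (perm132 r)" for x y
      using that unfolding set_append L lr by auto
  qed (use lr in simp_all)
  moreover have "distinct ?L" using lr by (simp add: distinct_map inj_on_def)
  then have "distinct (?L @ ?n # perm132 r)"
    unfolding distinct_append distinct.simps list.set L lr using lr by auto
  moreover have "set (?L @ ?n # perm132 r) = {1..?n}"
    unfolding set_append list.set L lr by auto
  ultimately show ?case
    unfolding avoiders_132_iff by simp
qed

lemma length_perm132 [simp]: "length (perm132 t) = size t"
  using perm132_avoider[of t] length_permutation[of "perm132 t"] by (simp add: avoiders_def)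

text \<open>By \<open>avoids132_around\<close> the entries before the maximum exceed those after it,
  so the remaining values split into two adjacent intervals. The surjectivity proofs of
  \<open>perm132\<close>, \<open>dumont132\<close> and \<open>dumont231\<close> all start from this
  split.\<close>

lemma avoiders132_split_at_max:
  assumes "xs \<in> permutations_of_set {1..Suc m}" "avoids132 xs"
  obtains ys zs where "xs = ys @ Suc m # zs" "distinct ys" "distinct zs" "avoids132 ys" "avoids132 zs"
    "set zs = {1..length zs}" "set ys = {length zs + 1..m}" "m = length ys + length zs"
proof -
  have "Suc m \<in> {1..Suc m}" by simp
  with assms(1) obtain ys zs where xs: "xs = ys @ Suc m # zs" "set ys \<union> set zs = {1..Suc m} - {Suc m}"
    and dist: "distinct ys" "distinct zs" "set ys \<inter> set zs = {}"
    by (rule permutations_of_set_split_at)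
  have union: "set ys \<union> set zs = {1..m}" unfolding xs(2) by auto
  have bound: "x < Suc m" if "x \<in> set ys \<union> set zs" for x using that unfolding union by simp
  have less: "z < y" if "y \<in> set ys" "z \<in> set zs" for y z
  proof -
    have "z \<le> y" using assms(2) xs(1) bound that by (intro avoids132_around[of ys "Suc m" zs]) auto
    then show ?thesis using dist(3) that by (metis disjoint_iff le_neq_implies_less)
  qed
  have sets: "set zs = {1..length zs}" "set ys = {length zs + 1..m}"
    using disjoint_below_intervals[OF union less] distinct_card[OF dist(2)] by simp_all
  have avoids: "avoids132 ys" "avoids132 zs"
    using avoids132_subseq[OF assms(2), of ys] avoids132_subseq[OF assms(2), of zs] xs(1)
      subseq_rev_drop_many[of ys ys "Suc m # zs"] subseq_drop_many[of zs "Suc m # zs" ys]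
    by (simp_all add: list_emb_Cons)
  have "m = length ys + length zs" using length_permutation[OF assms(1)] xs(1) by simp
  then show ?thesis by (rule that[OF xs(1) dist(1,2) avoids sets])
qed

lemma perm132_surj: "xs \<in> avoiders n [1, 3, 2] \<Longrightarrow> \<exists>t. size t = n \<and> perm132 t = xs"
proof (induction n arbitrary: xs rule: less_induct)
  case (less n)
  then have xs: "xs \<in> permutations_of_set {1..n}" "avoids132 xs"
    by (auto simp: avoiders_def avoids132_def)
  show ?case
  proof (cases n)
    case 0
    then show ?thesis using xs by (intro exI[of _ Leaf]) (auto simp: permutations_of_set_def)
  next
    case (Suc m)
    obtain ys zs where split: "xs = ys @ Suc m # zs" "distinct ys" "distinct zs" "avoids132 ys"
      "avoids132 zs" "set zs = {1..length zs}" "set ys = {length zs + 1..m}" "m = length ys + length zs"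
      using xs unfolding Suc by (rule avoiders132_split_at_max)
    have "set ys = {length zs + 1..length zs + length ys}" using split(7,8) by (simp add: add.commute)
    then obtain ys' where ys': "ys = map (\<lambda>x. x + length zs) ys'" "ys' \<in> permutations_of_set {1..length ys}"
      using permutation_shift_down split(2) by blast
    have "ys' \<in> avoiders (length ys) [1, 3, 2]"
      using ys' split(4) unfolding avoiders_132_iff by (simp add: permutations_of_set_def)
    moreover have "zs \<in> avoiders (length zs) [1, 3, 2]"
      using split unfolding avoiders_132_iff by simp
    ultimately obtain l r where "size l = length ys" "perm132 l = ys'" "size r = length zs" "perm132 r = zs"
      using less.IH[of "length ys" ys'] less.IH[of "length zs" zs] split(8) Suc by auto
    then show ?thesis using split ys' Suc by (intro exI[of _ "Node l r"]) auto
  qed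
qed

lemma perm132_image: "perm132 ` {t. size t = n} = avoiders n [1, 3, 2]"
  using perm132_avoider perm132_surj by (fastforce simp: image_iff)

section \<open>The map \<open>phi\<close> on the permutations of trees\<close>

fun west_path :: "nat \<Rightarrow> nat list \<Rightarrow> nat \<Rightarrow> step list" where
  "west_path s [] e = replicate (e - s) Down"
| "west_path s (h # hs) e = replicate (h - s) Down @ Up # west_path h hs e"

text \<open>The recursive form carries the start height, the crossing heights in order of traversal
  and the end height. Unlike the indexed definition of \<open>phi\<close> it can be cut at a
  crossing and, by the next lemma, translated.\<close>

lemma west_path_append: "west_path s (hs @ h # hs') e = west_path s hs h @ Up # west_path h hs' e"
  by (induction hs arbitrary: s) auto

lemma west_path_map_add: "west_path (s + k) (map (\<lambda>x. x + k) hs) (e + k) = west_path s hs e"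
  by (induction hs arbitrary: s) auto

text \<open>The bound keeps the last subtraction from truncating, so a higher end point costs
  exactly one more step. This step will close the final arch.\<close>

lemma west_path_Suc: "\<forall>h\<in>set (s # hs). h \<le> e \<Longrightarrow> west_path s hs (Suc e) = west_path s hs e @ [Down]"
  by (induction hs arbitrary: s) (auto simp: Suc_diff_le replicate_append_same)

definition west_heights :: "nat list \<Rightarrow> nat list" where
  "west_heights xs = map (west_height xs) (rev [1..<length xs + 1])"

lemma phi_conv_west_path: "phi xs = west_path 0 (west_heights xs) (length xs)"
proof -
  let ?N = "length xs"
  let ?start = "\<lambda>i. if i = ?N then 0 else west_height xs (i + 1)"
  \<comment> \<open>Generalized to the part of the path across columns \<open>m\<close> down to 1,
    where \<open>?start m\<close> is the height at which column \<open>m\<close> is reached. For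
    \<open>m = 0\<close> only the final climb remains, and \<open>m = ?N\<close> gives the whole
    path.\<close>
  have "concat (map (\<lambda>i. replicate (west_height xs i - ?start i) Down @ [Up]) (rev [1..<m + 1]))
        @ replicate (?N - (if m = 0 then ?start 0 else west_height xs 1)) Down =
      west_path (?start m) (map (west_height xs) (rev [1..<m + 1])) ?N" if "m \<le> ?N" for m
    using that
  proof (induction m)
    case (Suc m)
    then show ?case by (cases m) auto
  qed simp
  from this[of ?N] show ?thesis
    by (cases "xs = []") (simp_all add: phi_def west_heights_def Let_def del: upt_Suc)
qed

text \<open>The prefix minima in the left block are those of the block itself, shifted. At the
  maximum the prefix holds exactly the values above \<open>size r\<close>. After it the entries of
  the right block are the smallest and decide alone. Columns are listed from right to left, so the
  right block comes first.\<close>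

lemma west_heights_perm132_Node:
  "west_heights (perm132 (Node l r)) =
     west_heights (perm132 r) @ size r # map (\<lambda>x. x + size r) (west_heights (perm132 l))"
proof -
  let ?L = "map (\<lambda>x. x + size r) (perm132 l)" and ?n = "size l + size r + 1"
  let ?xs = "?L @ ?n # perm132 r"
  have sets: "set (perm132 l) = {1..size l}" "set (perm132 r) = {1..size r}"
    using perm132_avoider unfolding avoiders_132_iff by blast+
  have L: "set ?L = {size r + 1..size r + size l}"
    using sets(1) by (rule set_map_add_atLeastAtMost)
  have right: "west_height ?xs (size l + 1 + i) = west_height (perm132 r) i" if "i \<in> {1..size r}" for i
  proof -
    let ?T = "set (take i (perm132 r))"
    have ne: "?T \<noteq> {}" using that by (auto simp flip: length_0_conv)
    have sub: "?T \<subseteq> {1..size r}" using sets(2) by (metis set_take_subset)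
    have "set (take (size l + 1 + i) ?xs) = set (?L @ [?n]) \<union> ?T" by (simp add: take_Cons')
    also have "Min \<dots> = min (Min (set (?L @ [?n]))) (Min ?T)"
      using ne by (intro Min_Un) auto
    also have "\<dots> = Min ?T"
    proof (rule min_absorb2)
      have "Min ?T \<in> ?T" using ne by simp
      then have "Min ?T \<le> size r" using sub by auto
      moreover have "Min (set (?L @ [?n])) \<in> set (?L @ [?n])" by (intro Min_in) auto
      then have "size r \<le> Min (set (?L @ [?n]))" unfolding set_append L by auto
      ultimately show "Min ?T \<le> Min (set (?L @ [?n]))" by simp
    qed
    finally show ?thesis by (simp add: west_height_def)
  qed
  have middle: "west_height ?xs (size l + 1) = size r"
  proof -
    have "set (take (size l + 1) ?xs) = {size r + 1..?n}"
      using L by (auto simp: take_Cons')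
    moreover have "Min {size r + 1..?n} = size r + 1" by (intro Min_eqI) auto
    ultimately show ?thesis by (simp add: west_height_def)
  qed
  have left: "west_height ?xs i = west_height (perm132 l) i + size r" if "i \<in> {1..size l}" for i
  proof -
    let ?T = "set (take i (perm132 l))"
    have ne: "?T \<noteq> {}" using that by (auto simp flip: length_0_conv)
    then have "Min ?T \<in> ?T" by simp
    then have "Min ?T \<ge> 1" using sets(1) by (metis atLeastAtMost_iff in_set_takeD)
    moreover have "Min ((\<lambda>x. x + size r) ` ?T) = Min ?T + size r"
      using ne by (intro mono_Min_commute[symmetric]) (auto simp: mono_def)
    moreover have "set (take i ?xs) = (\<lambda>x. x + size r) ` ?T"
      using that by (simp add: take_map)
    ultimately show ?thesis by (simp add: west_height_def)
  qed
  have "rev [1..<?n + 1] = map (\<lambda>i. size l + 1 + i) (rev [1..<size r + 1]) @ (size l + 1) # rev [1..<size l + 1]"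
  proof -
    have "[1..<?n + 1] = [1..<size l + 1] @ (size l + 1) # [size l + 2..<?n + 1]"
      using upt_add_eq_append[of 1 "size l + 1" "size r + 1"] by (simp add: upt_conv_Cons del: upt_Suc)
    moreover have "[size l + 2..<?n + 1] = map (\<lambda>i. i + (size l + 1)) [1..<size r + 1]"
      by (rule nth_equalityI) (simp_all del: upt_Suc)
    ultimately show ?thesis by (simp add: rev_map add.commute)
  qed
  then have "west_heights ?xs = map (west_height ?xs) \<dots>"
    by (simp add: west_heights_def)
  also have "\<dots> = west_heights (perm132 r) @ size r # map (\<lambda>x. x + size r) (west_heights (perm132 l))"
    using left right middle by (auto simp: west_heights_def)
  finally show ?thesis by simp
qed

text \<open>The path is cut at the column of the maximum. The part before the cut is the path of the
  right block. The part after it is the path of the left block, translated by \<open>size r\<close>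
  and ending one unit higher.\<close>

lemma phi_perm132: "phi (perm132 t) = dyck_word t"
proof (induction t)
  case Leaf
  show ?case by (simp add: phi_conv_west_path west_heights_def)
next
  case (Node l r)
  have sets: "set (perm132 l) = {1..size l}"
    using perm132_avoider unfolding avoiders_132_iff by blast
  \<comment> \<open>No crossing lies above the end height of the left path, as
    \<open>west_path_Suc\<close> requires.\<close>
  have bound: "h \<le> size l" if "h \<in> set (west_heights (perm132 l))" for h
  proof -
    from that obtain i where i: "i \<in> {1..size l}" "h = west_height (perm132 l) i"
      by (auto simp: west_heights_def image_iff less_Suc_eq_le simp del: upt_Suc)
    then have "set (take i (perm132 l)) \<noteq> {}" by (auto simp flip: length_0_conv)
    then have "Min (set (take i (perm132 l))) \<in> set (take i (perm132 l))" by simp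
    then have "Min (set (take i (perm132 l))) \<le> size l" using sets by (auto dest: in_set_takeD)
    then show ?thesis using i by (simp add: west_height_def)
  qed
  have "phi (perm132 (Node l r)) = phi (perm132 r) @ Up #
      west_path (0 + size r) (map (\<lambda>x. x + size r) (west_heights (perm132 l))) (Suc (size l) + size r)"
    unfolding phi_conv_west_path west_heights_perm132_Node west_path_append by simp
  also have "\<dots> = phi (perm132 r) @ Up # phi (perm132 l) @ [Down]"
    unfolding west_path_map_add using bound by (subst west_path_Suc) (auto simp: phi_conv_west_path)
  finally show ?case using Node by simp
qed

section \<open>Dumont permutations of the first kind\<close>

abbreviation dumont1_step :: "nat \<Rightarrow> nat \<Rightarrow> bool" where
  "dumont1_step x y \<equiv> (if even x then y < x else x < y)"

lemma all_less_split_last: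
  "(\<forall>i<m. if Suc i < m then P i else Q i) \<longleftrightarrow> (\<forall>i. Suc i < m \<longrightarrow> P i) \<and> (m \<noteq> 0 \<longrightarrow> Q (m - 1))"
proof (cases m)
  case (Suc k)
  then have "(\<forall>i<m. if Suc i < m then P i else Q i) \<longleftrightarrow>
      (\<forall>i<k. if Suc i < m then P i else Q i) \<and> (if Suc k < m then P k else Q k)"
    by (simp only: All_less_Suc) blast
  with Suc show ?thesis by simp
qed simp

text \<open>At the last position the condition on even entries fails and the one on odd entries
  holds, so only parity is left there. Everywhere else it is a comparison with the next
  entry.\<close>

lemma dumont1_iff_successively:
  "dumont1 n \<pi> \<longleftrightarrow> set \<pi> = {1..2 * n} \<and> distinct \<pi> \<and> successively dumont1_step \<pi> \<and>
     (\<pi> \<noteq> [] \<longrightarrow> odd (last \<pi>))"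
proof (cases "\<pi> \<in> permutations_of_set {1..2 * n}")
  case True
  then have len: "length \<pi> = 2 * n" by (rule length_permutation)
  let ?C = "\<lambda>i. (even (entry \<pi> i) \<longrightarrow> i < 2 * n \<and> entry \<pi> i > entry \<pi> (i + 1)) \<and>
        (odd (entry \<pi> i) \<longrightarrow> i = 2 * n \<or> entry \<pi> i < entry \<pi> (i + 1))"
  have "{1..2 * n} = Suc ` {..<2 * n}" by (simp only: image_Suc_lessThan)
  then have "(\<forall>i\<in>{1..2 * n}. ?C i) \<longleftrightarrow> (\<forall>i<2 * n. ?C (Suc i))" by (simp only: ball_simps lessThan_iff Ball_def)
      blast
  also have "\<dots> \<longleftrightarrow> (\<forall>i<2 * n. if Suc i < 2 * n then dumont1_step (\<pi> ! i) (\<pi> ! Suc i) else odd (\<pi> ! i))"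
    by (intro all_cong1 imp_cong refl) (auto simp: entry_def)
  also have "\<dots> \<longleftrightarrow> (\<forall>i. Suc i < 2 * n \<longrightarrow> dumont1_step (\<pi> ! i) (\<pi> ! Suc i)) \<and>
      (2 * n \<noteq> 0 \<longrightarrow> odd (\<pi> ! (2 * n - 1)))"
    by (rule all_less_split_last)
  also have "\<dots> \<longleftrightarrow> successively dumont1_step \<pi> \<and> (\<pi> \<noteq> [] \<longrightarrow> odd (last \<pi>))"
    unfolding successively_conv_nth len[symmetric] length_0_conv by (simp add: last_conv_nth)
  finally have iff: "(\<forall>i\<in>{1..2 * n}. ?C i) \<longleftrightarrow> successively dumont1_step \<pi> \<and> (\<pi> \<noteq> [] \<longrightarrow> odd (last \<pi>))" .
  have "set \<pi> = {1..2 * n}" "distinct \<pi>" using True unfolding permutations_of_set_interval_iff by simp_all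
  then show ?thesis unfolding dumont1_def iff using True by (simp only: simp_thms)
next
  case False
  then have "\<not> (set \<pi> = {1..2 * n} \<and> distinct \<pi>)" unfolding permutations_of_set_interval_iff .
  then show ?thesis using False by (simp only: dumont1_def simp_thms) (simp only: conj_assoc[symmetric] simp_thms)
qed

text \<open>The part of the Dumont condition that does not mention the set of values, so that it
  applies to blocks of a permutation.\<close>

definition dumont1_word :: "nat list \<Rightarrow> bool" where
  "dumont1_word xs \<longleftrightarrow> successively dumont1_step xs \<and> (xs \<noteq> [] \<longrightarrow> odd (last xs))"

lemma dumont1_iff_word:
  "dumont1 n \<pi> \<longleftrightarrow> set \<pi> = {1..2 * n} \<and> distinct \<pi> \<and> dumont1_word \<pi>"
  by (simp add: dumont1_iff_successively dumont1_word_def del: One_nat_def)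

lemma dumont1_word_Nil [simp]: "dumont1_word []"
  by (simp add: dumont1_word_def)

lemma dumont1_word_map_add [simp]: "dumont1_word (map (\<lambda>x. x + 2 * k) xs) \<longleftrightarrow> dumont1_word xs"
  by (simp add: dumont1_word_def successively_map last_map cong: if_cong)

lemma dumont1_word_single [simp]: "dumont1_word [x] \<longleftrightarrow> odd x"
  by (simp add: dumont1_word_def)

lemma dumont1_word_Cons:
  "xs \<noteq> [] \<Longrightarrow> dumont1_word (x # xs) \<longleftrightarrow> dumont1_step x (hd xs) \<and> dumont1_word xs"
  by (auto simp: dumont1_word_def successively_Cons)

lemma dumont1_word_Cons_even:
  assumes "dumont1_word xs" "xs \<noteq> []" "even m" "\<And>x. x \<in> set xs \<Longrightarrow> x < m"
  shows "dumont1_word (m # xs)"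
  using assms by (simp add: dumont1_word_Cons)

text \<open>The last entry of \<open>xs\<close> is odd and so has to be followed by something
  larger, which \<open>y\<close> is.\<close>

lemma dumont1_word_append_odd:
  assumes "dumont1_word xs" "dumont1_word (y # ys)" "\<And>x. x \<in> set xs \<Longrightarrow> x < y"
  shows "dumont1_word (xs @ y # ys)"
proof (cases "xs = []")
  case False
  then have "last xs < y" using assms(3) by simp
  then show ?thesis using assms(1,2) False by (simp add: dumont1_word_def successively_append_iff)
qed (use assms in simp)

lemma dumont1_word_appendD2:
  assumes "dumont1_word (xs @ ys)" shows "dumont1_word ys"
  using assms by (auto simp: dumont1_word_def successively_append_iff)

text \<open>The last entry of \<open>xs\<close> is followed by the larger \<open>y\<close>; an
  ascent starts at an odd entry, and an odd last entry is what a Dumont word needs.\<close>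

lemma dumont1_word_appendD1:
  assumes "dumont1_word (xs @ y # ys)" "\<And>x. x \<in> set xs \<Longrightarrow> x < y"
  shows "dumont1_word xs"
proof (cases "xs = []")
  case False
  then have "last xs < y" using assms(2) by simp
  then show ?thesis using assms(1) by (auto simp: dumont1_word_def successively_append_iff)
qed simp

lemma dumont1_word_odd_ascends: "dumont1_word (xs @ m # y # ys) \<Longrightarrow> odd m \<Longrightarrow> m < y"
  by (simp add: dumont1_word_def successively_append_iff)

lemma dumont1_word_even_descends:
  assumes "dumont1_word (xs @ m # ys)" "even m"
  shows "ys \<noteq> []" "hd ys < m"
  using dumont1_word_appendD2[OF assms(1)] assms(2) by (cases "ys = []"; simp add: dumont1_word_Cons)+

text \<open>An even \<open>k\<close> would descend, and its successor still belongs to the block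
  because \<open>y\<close> closes it. This will force the lower block of a decomposition to have
  even length.\<close>

lemma dumont1_word_Min_odd:
  assumes "dumont1_word (us @ (xs @ [y]) @ vs)" "k \<in> set xs" "\<And>x. x \<in> set (xs @ [y]) \<Longrightarrow> k \<le> x"
  shows "odd k"
proof
  assume "even k"
  obtain cs ds where "xs = cs @ k # ds" using split_list[OF assms(2)] by blast
  with assms(1) have "dumont1_word ((us @ cs) @ k # ds @ y # vs)" by simp
  then have "hd (ds @ y # vs) < k" using \<open>even k\<close> by (rule dumont1_word_even_descends)
  moreover have "hd (ds @ y # vs) \<in> set (xs @ [y])" using \<open>xs = cs @ k # ds\<close> by (cases ds) auto
  ultimately show False using assms(3) by (meson not_le)
qed

text \<open>The even maximum needs a smaller successor. A nonempty right block supplies it; for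
  \<open>r = Leaf\<close> the maximum moves to the front instead, and the second largest entry stays
  at the end, where \<open>f1\<close> needs it.\<close>

fun dumont132 :: "btree \<Rightarrow> nat list" where
  "dumont132 Leaf = []"
| "dumont132 (Node l r) =
     (if r = Leaf then (2 * size l + 2) # dumont132 l @ [2 * size l + 1]
      else map (\<lambda>x. x + 2 * size r) (dumont132 l) @
        (2 * (size l + size r) + 1) # (2 * (size l + size r) + 2) # dumont132 r)"

text \<open>The second largest entry is odd, so it ends the word or is followed by the maximum. In
  the latter case the two and the successor of the maximum would form 231. So it always stands last,
  and one clause covers all trees.\<close>

fun dumont231 :: "btree \<Rightarrow> nat list" where
  "dumont231 Leaf = []"
| "dumont231 (Node l r) =
     dumont231 r @ (2 * (size l + size r) + 2) # map (\<lambda>x. x + 2 * size r) (dumont231 l) @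
       [2 * (size l + size r) + 1]"

lemma dumont1_avoiders_132_iff:
  "xs \<in> dumont1_avoiders n [1, 3, 2] \<longleftrightarrow>
     set xs = {1..2 * n} \<and> distinct xs \<and> dumont1_word xs \<and> avoids132 xs"
  by (auto simp: dumont1_avoiders_def dumont1_iff_word avoids132_def simp del: One_nat_def)

lemma dumont1_avoiders_231_iff:
  "xs \<in> dumont1_avoiders n [2, 3, 1] \<longleftrightarrow>
     set xs = {1..2 * n} \<and> distinct xs \<and> dumont1_word xs \<and> avoids132 (rev xs)"
  by (auto simp: dumont1_avoiders_def dumont1_iff_word avoids132_def contains_231 simp del: One_nat_def)

lemma filter_map_add_even:
  "filter odd (map (\<lambda>x. x + 2 * k) xs) = map (\<lambda>x. x + 2 * k) (filter odd xs)"
  "filter even (map (\<lambda>x. x + 2 * k) xs) = map (\<lambda>x. x + 2 * k) (filter even xs)"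
  for k :: nat
  by (simp_all add: filter_map o_def)

lemma f1_dumont132: "f1 (dumont132 t) = perm132 t"
proof (induction t)
  case (Node l r)
  have "f1 (map (\<lambda>x. x + 2 * size r) (dumont132 l)) = map (\<lambda>x. x + size r) (f1 (dumont132 l))"
    unfolding f1_def filter_map_add_even by (simp add: algebra_simps)
  moreover have "f1 (xs @ ys) = f1 xs @ f1 ys" "f1 [] = []"
    "f1 (x # xs) = (if odd x then (x + 1) div 2 # f1 xs else f1 xs)" for x xs ys
    by (simp_all add: f1_def)
  ultimately show ?case using Node by simp
qed (simp add: f1_def)

lemma f2_dumont231: "f2 (dumont231 t) = rev (perm132 t)"
proof (induction t)
  case (Node l r)
  have "f2 (map (\<lambda>x. x + 2 * size r) (dumont231 l)) = map (\<lambda>x. x + size r) (f2 (dumont231 l))"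
    unfolding f2_def filter_map_add_even by (simp add: algebra_simps)
  moreover have "f2 (xs @ ys) = f2 xs @ f2 ys" "f2 [] = []"
    "f2 (x # xs) = (if even x then x div 2 # f2 xs else f2 xs)" for x xs ys
    by (simp_all add: f2_def)
  ultimately show ?case using Node by (simp add: rev_map)
qed (simp add: f2_def)

section \<open>The Dumont avoiders of the first kind are exactly the words of trees\<close>

lemma dumont132_avoider: "dumont132 t \<in> dumont1_avoiders (size t) [1, 3, 2]"
proof (induction t)
  case Leaf
  show ?case unfolding dumont1_avoiders_132_iff by simp
next
  case (Node l r)
  have l: "set (dumont132 l) = {1..2 * size l}" "distinct (dumont132 l)"
      "dumont1_word (dumont132 l)" "avoids132 (dumont132 l)"
    and r: "set (dumont132 r) = {1..2 * size r}" "distinct (dumont132 r)"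
      "dumont1_word (dumont132 r)" "avoids132 (dumont132 r)"
    using Node.IH unfolding dumont1_avoiders_132_iff by blast+
  show ?case
  proof (cases "r = Leaf")
    case True
    let ?m = "2 * size l" and ?xs = "dumont132 l"
    have "dumont1_word (?xs @ [?m + 1])"
      using l by (intro dumont1_word_append_odd) auto
    then have "dumont1_word ((?m + 2) # ?xs @ [?m + 1])"
      using l(1) by (intro dumont1_word_Cons_even) auto
    moreover have "avoids132 ([?m + 2] @ ?xs @ [?m + 1])"
      by (intro avoids132_append[OF _ avoids132_snoc]) (auto simp: l simp flip: One_nat_def)
    moreover have "set ((?m + 2) # ?xs @ [?m + 1]) = {1..?m + 2}"
      unfolding set_append list.set l by auto
    ultimately show ?thesis
      unfolding dumont1_avoiders_132_iff using True l by simp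
  next
    case False
    let ?L = "map (\<lambda>x. x + 2 * size r) (dumont132 l)" and ?m = "2 * (size l + size r)"
      and ?R = "dumont132 r"
    have L: "set ?L = {2 * size r + 1..2 * size r + 2 * size l}"
      using l(1) by (rule set_map_add_atLeastAtMost)
    have "?R \<noteq> []" using False by (cases r) auto
    then have "dumont1_word ((?m + 2) # ?R)"
      using r(1,3) by (intro dumont1_word_Cons_even) auto
    then have "dumont1_word ((?m + 1) # (?m + 2) # ?R)" by (simp add: dumont1_word_Cons)
    then have "dumont1_word (?L @ (?m + 1) # (?m + 2) # ?R)"
    proof (intro dumont1_word_append_odd)
      show "x < ?m + 1" if "x \<in> set ?L" for x using that unfolding L by simp
    qed (use l in simp_all)
    moreover have "avoids132 ((?L @ [?m + 1]) @ [?m + 2])"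
    proof (intro avoids132_snoc)
      show "x \<le> ?m + 1" if "x \<in> set ?L" for x using that unfolding L by simp
      show "x \<le> ?m + 2" if "x \<in> set (?L @ [?m + 1])" for x using that unfolding set_append L by auto
    qed (use l in simp)
    then have "avoids132 (((?L @ [?m + 1]) @ [?m + 2]) @ ?R)"
    proof (rule avoids132_append)
      show "y < x" if "x \<in> set ((?L @ [?m + 1]) @ [?m + 2])" "y \<in> set ?R" for x y
        using that unfolding set_append L r by auto
    qed (use r in simp)
    moreover have "set (?L @ (?m + 1) # (?m + 2) # ?R) = {1..?m + 2}"
      unfolding set_append list.set L r by auto
    moreover have "distinct ?L" using l by (simp add: distinct_map inj_on_def)
    then have "distinct (?L @ (?m + 1) # (?m + 2) # ?R)"
      unfolding distinct_append distinct.simps list.set L r using r(2) by auto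
    ultimately show ?thesis
      unfolding dumont1_avoiders_132_iff using False by simp
  qed
qed

lemma dumont231_avoider: "dumont231 t \<in> dumont1_avoiders (size t) [2, 3, 1]"
proof (induction t)
  case Leaf
  show ?case unfolding dumont1_avoiders_231_iff by simp
next
  case (Node l r)
  have l: "set (dumont231 l) = {1..2 * size l}" "distinct (dumont231 l)"
      "dumont1_word (dumont231 l)" "avoids132 (rev (dumont231 l))"
    and r: "set (dumont231 r) = {1..2 * size r}" "distinct (dumont231 r)"
      "dumont1_word (dumont231 r)" "avoids132 (rev (dumont231 r))"
    using Node.IH unfolding dumont1_avoiders_231_iff by blast+
  let ?L = "map (\<lambda>x. x + 2 * size r) (dumont231 l)" and ?m = "2 * (size l + size r)"
    and ?R = "dumont231 r"
  have L: "set ?L = {2 * size r + 1..2 * size r + 2 * size l}"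
    using l(1) by (rule set_map_add_atLeastAtMost)
  have less: "x < ?m + 1" if "x \<in> set ?L" for x using that unfolding L by simp
  have "dumont1_word (?L @ [?m + 1])"
    using l less by (intro dumont1_word_append_odd) auto
  then have "dumont1_word ((?m + 2) # ?L @ [?m + 1])"
    using less by (intro dumont1_word_Cons_even) (auto intro: less_SucI simp del: set_map)
  then have "dumont1_word (?R @ (?m + 2) # ?L @ [?m + 1])"
    using r by (intro dumont1_word_append_odd) auto
  \<comment> \<open>The reversal is assembled from the left: \<open>?m + 1\<close> lies above
    \<open>?L\<close>, then \<open>?m + 2\<close> above everything so far, and \<open>rev ?R\<close>
    below all of it.\<close>
  moreover have "avoids132 ([?m + 1] @ rev ?L)"
    using l less by (intro avoids132_append) (auto simp: rev_map)
  then have "avoids132 (([?m + 1] @ rev ?L) @ [?m + 2])"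
  proof (rule avoids132_snoc)
    show "x \<le> ?m + 2" if "x \<in> set ([?m + 1] @ rev ?L)" for x
      using that unfolding set_append set_rev L by auto
  qed
  then have "avoids132 ((([?m + 1] @ rev ?L) @ [?m + 2]) @ rev ?R)"
  proof (rule avoids132_append)
    show "y < x" if "x \<in> set (([?m + 1] @ rev ?L) @ [?m + 2])" "y \<in> set (rev ?R)" for x y
      using that unfolding set_append set_rev L r by auto
  qed (use r in simp)
  moreover have "set (?R @ (?m + 2) # ?L @ [?m + 1]) = {1..?m + 2}"
    unfolding set_append list.set L r by auto
  moreover have "distinct ?L" using l by (simp add: distinct_map inj_on_def)
  then have "distinct (?R @ (?m + 2) # ?L @ [?m + 1])"
    unfolding distinct_append distinct.simps list.set set_append L r using r(2) by auto
  ultimately show ?case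
    unfolding dumont1_avoiders_231_iff by simp
qed

text \<open>The place of the second largest value decides the shape. Being odd, it either ends the
  word or is followed directly by the maximum; these cases correspond to an empty and a nonempty
  block before the maximum.\<close>

lemma dumont132_surj: "xs \<in> dumont1_avoiders n [1, 3, 2] \<Longrightarrow> \<exists>t. size t = n \<and> dumont132 t = xs"
proof (induction n arbitrary: xs rule: less_induct)
  case (less n)
  then have xs: "set xs = {1..2 * n}" "distinct xs" "dumont1_word xs" "avoids132 xs"
    unfolding dumont1_avoiders_132_iff by blast+
  show ?case
  proof (cases n)
    case 0
    then show ?thesis using xs(1) by (intro exI[of _ Leaf]) simp
  next
    case (Suc m)
    have "xs \<in> permutations_of_set {1..Suc (2 * m + 1)}"
      using xs(1,2) Suc by (simp add: permutations_of_set_def)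
    from this xs(4) obtain ys zs where split: "xs = ys @ Suc (2 * m + 1) # zs" "distinct ys" "distinct zs"
      "avoids132 ys" "avoids132 zs" "set zs = {1..length zs}" "set ys = {length zs + 1..2 * m + 1}"
      "2 * m + 1 = length ys + length zs"
      by (rule avoiders132_split_at_max)
    have "dumont1_word (Suc (2 * m + 1) # zs)"
      using xs(3) dumont1_word_appendD2 unfolding split(1) by blast
    then have zs: "zs \<noteq> []" "dumont1_word zs"
      using dumont1_word_even_descends[of "[]" "Suc (2 * m + 1)" zs]
        dumont1_word_appendD2[of "[Suc (2 * m + 1)]" zs] by auto
    show ?thesis
    proof (cases "ys = []")
      case True
      then have set_zs: "set zs = {1..2 * m + 1}" using split(6,8) by simp
      then have "2 * m + 1 \<in> set zs" by simp
      then obtain as bs where ab: "zs = as @ (2 * m + 1) # bs" by (meson split_list)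
      \<comment> \<open>The odd entry \<open>2 * m + 1\<close> would have to ascend, but only the
        maximum exceeds it, and that stands in front.\<close>
      have "bs = []"
      proof (cases bs)
        case (Cons b bs')
        then have "2 * m + 1 < b" using zs(2) ab dumont1_word_odd_ascends by simp
        moreover have "b \<in> set zs" using ab Cons by simp
        ultimately show ?thesis unfolding set_zs by simp
      qed
      then have zs_eq: "zs = as @ [2 * m + 1]" using ab by simp
      have "set as = set zs - {2 * m + 1}" using split(3) unfolding zs_eq by auto
      also have "\<dots> = {1..2 * m}" unfolding set_zs by auto
      finally have as: "set as = {1..2 * m}" .
      have "x < 2 * m + 1" if "x \<in> set as" for x using that unfolding as by simp
      then have "dumont1_word as" using zs(2) dumont1_word_appendD1 unfolding zs_eq by blast
      moreover have "avoids132 as"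
        using avoids132_subseq[OF split(5)] subseq_rev_drop_many[of as as] unfolding zs_eq by simp
      moreover have "distinct as" using split(3) zs_eq by simp
      ultimately have "as \<in> dumont1_avoiders m [1, 3, 2]" using as unfolding dumont1_avoiders_132_iff by blast
      then obtain l where "size l = m" "dumont132 l = as" using less.IH[of m] Suc by blast
      then show ?thesis using Suc split(1) True zs_eq by (intro exI[of _ "Node l Leaf"]) simp
    next
      case False
      then have "length ys \<noteq> 0" by simp
      then have le: "length zs + 1 \<le> 2 * m + 1" using split(8) by linarith
      then have "2 * m + 1 \<in> set ys" unfolding split(7) by simp
      then obtain as bs where ab: "ys = as @ (2 * m + 1) # bs" by (meson split_list)
      have "bs = []"
      proof (cases bs)
        case (Cons b bs')
        then have "2 * m + 1 < b"
          using xs(3) ab dumont1_word_odd_ascends[of as "2 * m + 1" b] unfolding split(1) by simp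
        moreover have "b \<in> set ys" using ab Cons by simp
        ultimately show ?thesis unfolding split(7) by simp
      qed
      then have ys_eq: "ys = as @ [2 * m + 1]" using ab by simp
      have "set as = set ys - {2 * m + 1}" using split(2) unfolding ys_eq by auto
      also have "\<dots> = {length zs + 1..2 * m}" unfolding split(7) by auto
      finally have as: "set as = {length zs + 1..2 * m}" .
      have "even (length zs)"
      proof (rule ccontr)
        assume odd: "odd (length zs)"
        \<comment> \<open>The inequality puts the minimum \<open>length zs + 1\<close> of the block
          into \<open>as\<close>, not at its closing entry. This minimum is even, contrary to
          \<open>dumont1_word_Min_odd\<close>.\<close>
        then have "length zs \<noteq> 2 * m" by auto
        then have "length zs + 1 \<in> set as" using le unfolding as by simp
        moreover have "length zs + 1 \<le> x" if "x \<in> set (as @ [2 * m + 1])" for x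
          using that unfolding ys_eq[symmetric] split(7) by simp
        moreover have "dumont1_word ([] @ (as @ [2 * m + 1]) @ Suc (2 * m + 1) # zs)"
          using xs(3) unfolding split(1) ys_eq by simp
        ultimately have "odd (length zs + 1)" using dumont1_word_Min_odd by blast
        then show False using odd by simp
      qed
      then obtain q where q: "length zs = 2 * q" by (elim evenE)
      define p where "p = m - q"
      have pq: "m = p + q" using le q by (simp add: p_def)
      have "set as = {2 * q + 1..2 * q + 2 * p}" unfolding as q pq by (simp add: algebra_simps)
      moreover have "distinct as" using split(2) ys_eq by simp
      ultimately obtain as' where as': "as = map (\<lambda>x. x + 2 * q) as'" "as' \<in> permutations_of_set {1..2 * p}"
        using permutation_shift_down by blast
      have "x < 2 * m + 1" if "x \<in> set as" for x using that unfolding as by simp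
      moreover have "dumont1_word (as @ (2 * m + 1) # Suc (2 * m + 1) # zs)"
        using xs(3) unfolding split(1) ys_eq by simp
      ultimately have "dumont1_word as" using dumont1_word_appendD1 by blast
      moreover have "avoids132 as"
        using avoids132_subseq[OF split(4)] subseq_rev_drop_many[of as as] unfolding ys_eq by simp
      ultimately have "as' \<in> dumont1_avoiders p [1, 3, 2]"
        using as'(2) unfolding dumont1_avoiders_132_iff permutations_of_set_interval_iff as'(1) by simp
      moreover have "zs \<in> dumont1_avoiders q [1, 3, 2]"
        using split(3,5,6) zs(2) q unfolding dumont1_avoiders_132_iff by metis
      ultimately obtain l r where lr: "size l = p" "dumont132 l = as'" "size r = q" "dumont132 r = zs"
        using less.IH[of p as'] less.IH[of q zs] Suc pq by auto
      have "r \<noteq> Leaf" using lr(4) zs(1) by auto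
      then show ?thesis using Suc split(1) ys_eq as'(1) lr pq by (intro exI[of _ "Node l r"]) simp
    qed
  qed
qed

text \<open>The split is applied to the reversal, so the upper block now follows the maximum. It is
  never empty, since an even entry needs a successor, and therefore always contains
  \<open>2 * m + 1\<close>.\<close>

lemma dumont231_surj: "xs \<in> dumont1_avoiders n [2, 3, 1] \<Longrightarrow> \<exists>t. size t = n \<and> dumont231 t = xs"
proof (induction n arbitrary: xs rule: less_induct)
  case (less n)
  then have xs: "set xs = {1..2 * n}" "distinct xs" "dumont1_word xs" "avoids132 (rev xs)"
    unfolding dumont1_avoiders_231_iff by blast+
  show ?case
  proof (cases n)
    case 0
    then show ?thesis using xs(1) by (intro exI[of _ Leaf]) simp
  next
    case (Suc m)
    have "rev xs \<in> permutations_of_set {1..Suc (2 * m + 1)}"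
      using xs(1,2) Suc by (simp add: permutations_of_set_def)
    from this xs(4) obtain ys' zs' where split': "rev xs = ys' @ Suc (2 * m + 1) # zs'" "distinct ys'" "distinct zs'"
      "avoids132 ys'" "avoids132 zs'" "set zs' = {1..length zs'}" "set ys' = {length zs' + 1..2 * m + 1}"
      "2 * m + 1 = length ys' + length zs'"
      by (rule avoiders132_split_at_max)
    define ys zs where "ys = rev zs'" and "zs = rev ys'"
    have xs_eq: "xs = ys @ Suc (2 * m + 1) # zs"
      using arg_cong[OF split'(1), of rev] by (simp add: ys_def zs_def)
    have len: "length ys = length zs'" by (simp add: ys_def)
    have split: "distinct ys" "distinct zs" "avoids132 (rev ys)" "avoids132 (rev zs)"
      using split'(2-5) by (simp_all add: ys_def zs_def)
    have set_ys: "set ys = {1..length ys}" unfolding len split'(6)[symmetric] by (simp add: ys_def)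
    have set_zs: "set zs = {length ys + 1..2 * m + 1}"
      unfolding len split'(7)[symmetric] by (simp add: zs_def)
    have sum: "2 * m + 1 = length ys + length zs" unfolding split'(8) by (simp add: ys_def zs_def)
    have "dumont1_word (Suc (2 * m + 1) # zs)"
      using xs(3) dumont1_word_appendD2 unfolding xs_eq by blast
    then have zs: "zs \<noteq> []" "dumont1_word zs"
      using dumont1_word_even_descends[of "[]" "Suc (2 * m + 1)" zs]
        dumont1_word_appendD2[of "[Suc (2 * m + 1)]" zs] by auto
    then have "length zs \<noteq> 0" by simp
    then have le: "length ys + 1 \<le> 2 * m + 1" using sum by linarith
    then have "2 * m + 1 \<in> set zs" unfolding set_zs by simp
    then obtain as bs where ab: "zs = as @ (2 * m + 1) # bs" by (meson split_list)
    have "bs = []"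
    proof (cases bs)
      case (Cons b bs')
      then have "2 * m + 1 < b" using zs(2) ab dumont1_word_odd_ascends by simp
      moreover have "b \<in> set zs" using ab Cons by simp
      ultimately show ?thesis unfolding set_zs by simp
    qed
    then have zs_eq: "zs = as @ [2 * m + 1]" using ab by simp
    have "set as = set zs - {2 * m + 1}" using split(2) unfolding zs_eq by auto
    also have "\<dots> = {length ys + 1..2 * m}" unfolding set_zs by auto
    finally have as: "set as = {length ys + 1..2 * m}" .
    have "even (length ys)"
    proof (rule ccontr)
      assume odd: "odd (length ys)"
      then have "length ys \<noteq> 2 * m" by auto
      then have "length ys + 1 \<in> set as" using le unfolding as by simp
      moreover have "length ys + 1 \<le> x" if "x \<in> set (as @ [2 * m + 1])" for x
        using that unfolding zs_eq[symmetric] set_zs by simp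
      \<comment> \<open>The upper block ends the word here, so nothing follows its closing
        entry.\<close>
      moreover have "dumont1_word ([] @ (as @ [2 * m + 1]) @ [])"
        using zs(2) unfolding zs_eq by simp
      ultimately have "odd (length ys + 1)" using dumont1_word_Min_odd by blast
      then show False using odd by simp
    qed
    then obtain q where q: "length ys = 2 * q" by (elim evenE)
    define p where "p = m - q"
    have pq: "m = p + q" using le q by (simp add: p_def)
    have "set as = {2 * q + 1..2 * q + 2 * p}" unfolding as q pq by (simp add: algebra_simps)
    moreover have "distinct as" using split(2) zs_eq by simp
    ultimately obtain as' where as': "as = map (\<lambda>x. x + 2 * q) as'" "as' \<in> permutations_of_set {1..2 * p}"
      using permutation_shift_down by blast
    have "x < 2 * m + 1" if "x \<in> set as" for x using that unfolding as by simp
    then have "dumont1_word as" using zs(2) dumont1_word_appendD1 unfolding zs_eq by blast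
    moreover have "avoids132 (rev as)"
      using avoids132_subseq[OF split(4)] unfolding zs_eq by (simp add: list_emb_Cons)
    ultimately have "as' \<in> dumont1_avoiders p [2, 3, 1]"
      using as'(2) unfolding dumont1_avoiders_231_iff permutations_of_set_interval_iff as'(1)
      by (simp add: rev_map)
    moreover have "x < Suc (2 * m + 1)" if "x \<in> set ys" for x using that le unfolding set_ys by simp
    then have "dumont1_word ys" using xs(3) dumont1_word_appendD1 unfolding xs_eq by blast
    then have "ys \<in> dumont1_avoiders q [2, 3, 1]"
      using split(1,3) set_ys q unfolding dumont1_avoiders_231_iff by metis
    ultimately obtain l r where "size l = p" "dumont231 l = as'" "size r = q" "dumont231 r = ys"
      using less.IH[of p as'] less.IH[of q ys] Suc pq by auto
    then show ?thesis using Suc xs_eq zs_eq as'(1) pq by (intro exI[of _ "Node l r"]) simp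
  qed
qed

lemma dumont132_image: "dumont132 ` {t. size t = n} = dumont1_avoiders n [1, 3, 2]"
  using dumont132_avoider dumont132_surj by (fastforce simp: image_iff)

lemma dumont231_image: "dumont231 ` {t. size t = n} = dumont1_avoiders n [2, 3, 1]"
  using dumont231_avoider dumont231_surj by (fastforce simp: image_iff)

section \<open>Dumont permutations of the second kind\<close>

fun east_path :: "nat \<Rightarrow> nat list \<Rightarrow> step list" where
  "east_path m [] = []"
| "east_path m (x # xs) = replicate (max m x - m) Up @ Down # east_path (max m x) xs"

lemma east_path_snoc:
  "east_path m (xs @ [x]) =
     east_path m xs @ replicate (max (fold max xs m) x - fold max xs m) Up @ [Down]"
  by (induction xs arbitrary: m) (simp_all add: max.commute)

lemma east_height_append: "i \<le> length xs \<Longrightarrow> east_height (xs @ ys) i = east_height xs i"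
  by (simp add: east_height_def)

lemma east_height_length: "east_height xs (length xs) = fold max xs 0"
proof (induction xs rule: rev_induct)
  case (snoc x xs)
  have "east_height (xs @ [x]) (length (xs @ [x])) = max x (east_height xs (length xs))"
    by (cases "xs = []") (auto simp: east_height_def)
  then show ?case using snoc by simp
qed (simp add: east_height_def)

text \<open>In \<open>east_path\<close> the number is the running maximum. The indexed
  \<open>psi\<close> suits induction from the right: a new last entry leaves the earlier east
  heights unchanged and adds one column.\<close>

lemma psi_conv_east_path: "psi xs = east_path 0 xs"
proof (induction xs rule: rev_induct)
  case (snoc x xs)
  let ?N = "length xs" and ?ys = "xs @ [x]"
  have "psi ?ys = concat (map (\<lambda>i. replicate (east_height ?ys i - east_height ?ys (i - 1)) Up @ [Down])
                 [1..<?N + 1]) @ replicate (east_height ?ys (?N + 1) - east_height ?ys ?N) Up @ [Down]"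
    by (simp add: psi_def)
  also have "map (\<lambda>i. replicate (east_height ?ys i - east_height ?ys (i - 1)) Up @ [Down]) [1..<?N + 1] =
      map (\<lambda>i. replicate (east_height xs i - east_height xs (i - 1)) Up @ [Down]) [1..<?N + 1]"
  proof (intro map_cong refl)
    fix i assume "i \<in> set [1..<?N + 1]"
    then have "i \<le> ?N" "i - 1 \<le> ?N" by auto
    then show "replicate (east_height ?ys i - east_height ?ys (i - 1)) Up @ [Down] =
        replicate (east_height xs i - east_height xs (i - 1)) Up @ [Down]"
      by (simp only: east_height_append)
  qed
  also have "concat \<dots> = psi xs" by (simp add: psi_def)
  also have "east_height ?ys (?N + 1) = max (fold max xs 0) x"
    using east_height_length[of ?ys] by (simp add: max.commute)
  also have "east_height ?ys ?N = fold max xs 0"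
    by (simp add: east_height_append east_height_length)
  finally show ?case using snoc by (simp add: east_path_snoc)
qed (simp add: psi_def)

fun interleave :: "'a list \<Rightarrow> 'a list \<Rightarrow> 'a list" where
  "interleave (x # xs) (y # ys) = x # y # interleave xs ys"
| "interleave _ _ = []"

lemma set_interleave: "length xs = length ys \<Longrightarrow> set (interleave xs ys) = set xs \<union> set ys"
  by (induction xs ys rule: list_induct2) auto

lemma length_interleave: "length xs = length ys \<Longrightarrow> length (interleave xs ys) = 2 * length xs"
  by (induction xs ys rule: list_induct2) auto

lemma distinct_interleave:
  "length xs = length ys \<Longrightarrow>
     distinct (interleave xs ys) \<longleftrightarrow> distinct xs \<and> distinct ys \<and> set xs \<inter> set ys = {}"
  by (induction xs ys rule: list_induct2) (auto simp: set_interleave)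

lemma nth_interleave:
  assumes "length xs = length ys" "i < length xs"
  shows "interleave xs ys ! (2 * i) = xs ! i" "interleave xs ys ! Suc (2 * i) = ys ! i"
  using assms by (induction xs ys arbitrary: i rule: list_induct2) (auto simp: nth_Cons split: nat.splits)

section \<open>Undoing the replacement of udd, and the positions of the letters of a path\<close>

fun expand_down :: "step list \<Rightarrow> step list" where
  "expand_down [] = []"
| "expand_down (Up # w) = Up # expand_down w"
| "expand_down (Down # w) = Up # Down # Down # expand_down w"

text \<open>An expanded word is empty or begins with \<open>Up\<close>, so an \<open>Up\<close>
  copied from \<open>w\<close> never starts an unwanted udd.\<close>

lemma replace_udd_expand_down: "replace_udd (expand_down w) = w"
proof (induction w rule: expand_down.induct)
  case (2 w)
  then show ?case by (cases w rule: expand_down.cases) auto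
qed auto

text \<open>\<open>k\<close> counts the letters already read. Positions start at 1 because they
  become the values of a permutation.\<close>

fun step_positions :: "step \<Rightarrow> nat \<Rightarrow> step list \<Rightarrow> nat list" where
  "step_positions s k [] = []"
| "step_positions s k (t # w) =
     (if t = s then Suc k # step_positions s (Suc k) w else step_positions s (Suc k) w)"

lemma step_positions_append:
  "step_positions s k (v @ w) = step_positions s k v @ step_positions s (k + length v) w"
  by (induction v arbitrary: k) auto

lemma set_step_positions:
  "x \<in> set (step_positions s k w) \<longleftrightarrow> k < x \<and> x \<le> k + length w \<and> w ! (x - Suc k) = s"
proof (induction w arbitrary: k)
  case (Cons t w)
  show ?case
  proof (cases "Suc k < x")
    case True
    then have "(t # w) ! (x - Suc k) = w ! (x - Suc (Suc k))" by (simp add: nth_Cons')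
    then show ?thesis using True Cons[of "Suc k"] by auto
  next
    case False
    then show ?thesis using Cons[of "Suc k"] by (cases "x = Suc k") auto
  qed
qed simp

lemma sorted_step_positions: "sorted_wrt (<) (step_positions s k w)"
  by (induction w arbitrary: k) (auto simp: set_step_positions)

lemma length_step_positions:
  "length (step_positions Up k w) + length (step_positions Down k w) = length w"
  "int (length (step_positions Up k w)) - int (length (step_positions Down k w)) = height w"
proof (induction w arbitrary: k)
  case (Cons t w)
  { case 1 show ?case using Cons.IH(1)[of "Suc k"] by (cases t) auto }
  { case 2 show ?case using Cons.IH(2)[of "Suc k"] by (cases t) auto }
qed auto

lemma length_step_positions_dyck:
  assumes "w \<in> dyck_paths n"
  shows "length (step_positions Up k w) = n" "length (step_positions Down k w) = n"
  using length_step_positions[of k w] assms by (auto simp: dyck_paths_def)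

text \<open>\<open>a\<close> and \<open>b\<close> count the letters \<open>Up\<close> and
  \<open>Down\<close> read before \<open>w\<close>, so the path as a whole stays nonnegative. The
  Down number \<open>b + i + 1\<close> is preceded by at least as many Ups, and the Up number
  \<open>a + i + 1\<close> by at most \<open>a + i\<close> Downs.\<close>

lemma step_positions_bounds:
  assumes "\<And>j. j \<le> length w \<Longrightarrow> height (take j w) + int a \<ge> int b"
  shows "(\<forall>i<length (step_positions Down (a + b) w). 2 * (b + i + 1) \<le> step_positions Down (a + b) w ! i) \<and>
    (\<forall>i<length (step_positions Up (a + b) w). step_positions Up (a + b) w ! i \<le> 2 * (a + i) + 1)"
  using assms
proof (induction w arbitrary: a b)
  case (Cons t w)
  have 0: "b \<le> a" using Cons.prems[of 0] by simp
  have 1: "int b \<le> step_value t + int a" using Cons.prems[of 1] by simp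
  have step: "height (take j w) + step_value t + int a \<ge> int b" if "j \<le> length w" for j
    using Cons.prems[of "Suc j"] that by simp
  show ?case
  proof (cases t)
    case Up
    then have "height (take j w) + int (Suc a) \<ge> int b" if "j \<le> length w" for j
      using step[OF that] by simp
    from Cons.IH[OF this] show ?thesis using Up 0 by (auto simp: nth_Cons split: nat.splits)
  next
    case Down
    then have "height (take j w) + int a \<ge> int (Suc b)" if "j \<le> length w" for j
      using step[OF that] by simp
    from Cons.IH[OF this] show ?thesis using Down 1 by (auto simp: nth_Cons split: nat.splits)
  qed
qed simp

text \<open>The path through the record heights \<open>ds\<close>: the second \<open>Down\<close> of
  each pair crosses the column of the smaller entry that follows the record.\<close>

fun record_path :: "nat \<Rightarrow> nat list \<Rightarrow> step list" where
  "record_path m [] = []"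
| "record_path m (d # ds) = replicate (d - m) Up @ Down # Down # record_path d ds"

lemma east_path_interleave:
  assumes "list_all2 (<) us ds" "sorted_wrt (<) ds" "\<And>d. d \<in> set ds \<Longrightarrow> m \<le> d"
  shows "east_path m (interleave ds us) = record_path m ds"
  using assms
proof (induction us ds arbitrary: m rule: list_all2_induct)
  case (Cons u us d ds)
  then have "east_path d (interleave ds us) = record_path d ds" by (simp add: less_imp_le)
  then show ?case using Cons.hyps(1) Cons.prems by (simp add: max_absorb1 max_absorb2)
qed simp

text \<open>With \<open>m\<close> the last record and \<open>k\<close> letters read,
  \<open>k - m\<close> Ups are pending. A \<open>Down\<close> in place \<open>k + 1\<close> releases
  them with one more Up and two Downs, so it becomes udd; as \<open>w\<close> ends in
  \<open>Down\<close>, none stays pending.\<close>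

lemma record_path_step_positions:
  assumes "m \<le> k" "w = [] \<Longrightarrow> m = k" "w \<noteq> [] \<Longrightarrow> last w = Down"
  shows "record_path m (step_positions Down k w) = replicate (k - m) Up @ expand_down w"
  using assms
proof (induction w arbitrary: m k)
  case (Cons t w)
  show ?case
  proof (cases t)
    case Up
    then have "w \<noteq> []" using Cons.prems by auto
    then show ?thesis using Up Cons.prems Cons.IH[of m "Suc k"]
      by (simp add: Suc_diff_le replicate_app_Cons_same)
  next
    case Down
    then show ?thesis using Cons.prems Cons.IH[of "Suc k" "Suc k"]
      by (simp add: Suc_diff_le replicate_app_Cons_same split: if_splits)
  qed
qed simp

lemma last_dyck_path:
  assumes "w \<in> dyck_paths n" "w \<noteq> []"
  shows "last w = Down"
proof -
  obtain v s where w: "w = v @ [s]" using assms(2) by (cases w rule: rev_cases) auto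
  have "length v \<le> length w" using w by simp
  then have "height (take (length v) w) \<ge> 0" "height w = 0"
    using assms(1) unfolding dyck_paths_def by blast+
  then show ?thesis unfolding w by (cases s) auto
qed

section \<open>Dyck paths and 321-avoiding Dumont permutations of the second kind\<close>

definition dumont321 :: "step list \<Rightarrow> nat list" where
  "dumont321 w = interleave (step_positions Down 0 w) (step_positions Up 0 w)"

lemma dyck_path_step_positions:
  assumes "w \<in> dyck_paths n" "i < n"
  shows "2 * i + 2 \<le> step_positions Down 0 w ! i" "step_positions Up 0 w ! i \<le> 2 * i + 1"
proof -
  have "\<And>j. j \<le> length w \<Longrightarrow> height (take j w) + int 0 \<ge> int 0"
    using assms(1) by (simp add: dyck_paths_def)
  from step_positions_bounds[OF this]
  show "2 * i + 2 \<le> step_positions Down 0 w ! i" "step_positions Up 0 w ! i \<le> 2 * i + 1"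
    using assms(2) by (simp_all add: length_step_positions_dyck[OF assms(1)])
qed

lemma replace_udd_psi_dumont321:
  assumes "w \<in> dyck_paths n"
  shows "replace_udd (psi (dumont321 w)) = w"
proof -
  have "list_all2 (<) (step_positions Up 0 w) (step_positions Down 0 w)"
    using dyck_path_step_positions[OF assms]
    by (force simp: list_all2_conv_all_nth length_step_positions_dyck[OF assms])
  then have "psi (dumont321 w) = record_path 0 (step_positions Down 0 w)"
    unfolding psi_conv_east_path dumont321_def using sorted_step_positions
    by (intro east_path_interleave) auto
  also have "\<dots> = expand_down w"
    using last_dyck_path[OF assms] by (subst record_path_step_positions) auto
  finally show ?thesis by (simp add: replace_udd_expand_down)
qed

text \<open>Among three positions two have the same parity, and entries in positions of one parity
  increase.\<close>

lemma avoids321_interleave: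
  assumes "length xs = length ys" "sorted_wrt (<) xs" "sorted_wrt (<) ys"
  shows "\<not> contains_pattern (interleave xs ys) [3, 2, 1]"
proof
  let ?p = "interleave xs ys"
  have even: "?p ! i < ?p ! j" if "i < j" "j < length ?p" "even i \<longleftrightarrow> even j" for i j
  proof (cases "even i")
    case True
    then have "even j" using that(3) by simp
    with True obtain a b where "i = 2 * a" "j = 2 * b" by (elim evenE)
    then show ?thesis using that assms by (simp add: nth_interleave length_interleave sorted_wrt_nth_less)
  next
    case False
    then have "odd j" using that(3) by simp
    with False obtain a b where "i = Suc (2 * a)" "j = Suc (2 * b)" by (elim oddE) simp
    then show ?thesis using that assms by (simp add: nth_interleave length_interleave sorted_wrt_nth_less)
  qed
  assume "contains_pattern ?p [3, 2, 1]"
  then obtain i j k where "i < j" "j < k" "k < length ?p" "?p ! k < ?p ! j" "?p ! j < ?p ! i"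
    unfolding contains_321 by blast
  then show False using even[of i j] even[of j k] even[of i k] by fastforce
qed

lemma dumont321_avoider:
  assumes "w \<in> dyck_paths n"
  shows "dumont321 w \<in> dumont2_avoiders n [3, 2, 1]"
proof -
  let ?ds = "step_positions Down 0 w" and ?us = "step_positions Up 0 w"
  have len: "length ?us = n" "length ?ds = n" by (rule length_step_positions_dyck[OF assms])+
  have "length w = 2 * n" using assms by (simp add: dyck_paths_def)
  then have "x \<in> set ?ds \<union> set ?us \<longleftrightarrow> x \<in> {1..2 * n}" for x
    by (cases "w ! (x - 1)") (auto simp: set_step_positions)
  then have "set (dumont321 w) = {1..2 * n}"
    unfolding dumont321_def using set_interleave[of ?ds ?us] len by blast
  moreover have "distinct (dumont321 w)"
    unfolding dumont321_def using len sorted_step_positions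
    by (auto simp: distinct_interleave strict_sorted_iff set_step_positions)
  ultimately have "dumont321 w \<in> permutations_of_set {1..2 * n}"
    by (rule permutations_of_setI)
  \<comment> \<open>With \<open>i = Suc k\<close>, the positions \<open>2 * i - 1\<close> and
    \<open>2 * i\<close> hold letter positions number \<open>k\<close> of \<open>Down\<close> and
    \<open>Up\<close>, whose bounds yield the two inequalities.\<close>
  moreover have "entry (dumont321 w) (2 * i) < 2 * i \<and> entry (dumont321 w) (2 * i - 1) \<ge> 2 * i - 1"
    if i: "i \<in> {1..n}" for i
  proof -
    obtain k where k: "i = Suc k" "k < n" using i by (cases i) auto
    then show ?thesis
      using dyck_path_step_positions[OF assms k(2)] nth_interleave[of ?ds ?us k] len
      by (simp add: entry_def dumont321_def)
  qed
  moreover have "\<not> contains_pattern (dumont321 w) [3, 2, 1]"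
    unfolding dumont321_def using len sorted_step_positions by (intro avoids321_interleave) simp_all
  ultimately show ?thesis by (simp add: dumont2_avoiders_def dumont2_def)
qed

lemma dumont321_surj:
  assumes "\<pi> \<in> dumont2_avoiders n [3, 2, 1]"
  obtains w where "w \<in> dyck_paths n" "dumont321 w = \<pi>"
proof -
  have perm: "\<pi> \<in> permutations_of_set {1..2 * n}" and avoid: "\<not> contains_pattern \<pi> [3, 2, 1]"
    and D: "\<And>i. i \<in> {1..n} \<Longrightarrow> entry \<pi> (2 * i) < 2 * i \<and> entry \<pi> (2 * i - 1) \<ge> 2 * i - 1"
    using assms by (auto simp: dumont2_avoiders_def dumont2_def)
  have len: "length \<pi> = 2 * n" using perm by (rule length_permutation)
  have set: "set \<pi> = {1..2 * n}" "distinct \<pi>" using perm unfolding permutations_of_set_interval_iff by blast+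
  have small: "\<pi> ! Suc (2 * i) \<le> 2 * i + 1" and large: "2 * i + 1 \<le> \<pi> ! (2 * i)" if "i < n" for i
    using D[of "Suc i"] that by (auto simp: entry_def)
  have neq: "\<pi> ! i \<noteq> \<pi> ! j" if "i \<noteq> j" "i < 2 * n" "j < 2 * n" for i j
    using that set(2) len by (simp add: nth_eq_iff_index_eq)
  have card_take: "card (set (take k \<pi>)) = k" if "k \<le> 2 * n" for k
    using that set(2) len by (simp add: distinct_card)
  have no321: "\<pi> ! j < \<pi> ! k" if "i < j" "j < k" "k < 2 * n" "\<pi> ! j < \<pi> ! i" for i j k
  proof (rule ccontr)
    assume "\<not> ?thesis"
    then have "\<pi> ! k < \<pi> ! j" using neq[of j k] that by simp
    then show False using avoid that len unfolding contains_321 by metis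
  qed
  have take_nth: "x \<in> set (take k \<pi>) \<longleftrightarrow> (\<exists>j<k. x = \<pi> ! j)" if "k \<le> 2 * n" for x k
    using that len by (auto simp: in_set_conv_nth)
  \<comment> \<open>Otherwise the first \<open>2 * i + 2\<close> entries would all be at most
    \<open>2 * i + 1\<close>, more entries than values.\<close>
  have not_record: "\<exists>p<Suc (2 * i). \<pi> ! Suc (2 * i) < \<pi> ! p" if i: "i < n" for i
  proof (rule ccontr)
    assume *: "\<not> ?thesis"
    have "set (take (2 * i + 2) \<pi>) \<subseteq> {1..2 * i + 1}"
    proof
      fix x assume x: "x \<in> set (take (2 * i + 2) \<pi>)"
      have "2 * i + 2 \<le> 2 * n" using i by simp
      from x[unfolded take_nth[OF this]] obtain p where p: "p < 2 * i + 2" "x = \<pi> ! p" by blast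
      then consider "p < Suc (2 * i)" | "p = Suc (2 * i)" by linarith
      then have "x \<le> \<pi> ! Suc (2 * i)"
      proof cases
        case 1
        then show ?thesis using * p(2) by (meson not_le)
      qed (simp add: p)
      moreover have "x \<in> {1..2 * n}" using in_set_takeD[OF x] unfolding set(1) .
      ultimately show "x \<in> {1..2 * i + 1}" using small[OF i] by simp
    qed
    then have "card (set (take (2 * i + 2) \<pi>)) \<le> card {1..2 * i + 1}" by (intro card_mono) simp
    then show False using card_take[of "2 * i + 2"] i by simp
  qed
  \<comment> \<open>If an earlier \<open>\<pi> ! p\<close> were larger, no entry after index
    \<open>2 * i\<close> could be below \<open>\<pi> ! (2 * i)\<close>. Then the first
    \<open>2 * i + 1\<close> entries would hold all of \<open>{1..2 * i + 1}\<close> and also the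
    larger \<open>\<pi> ! p\<close>, one value too many.\<close>
  have is_record: "\<pi> ! p < \<pi> ! (2 * i)" if i: "i < n" and p: "p < 2 * i" for i p
  proof (rule ccontr)
    assume "\<not> ?thesis"
    then have less: "\<pi> ! (2 * i) < \<pi> ! p" using neq[of p "2 * i"] i p by simp
    have len_le: "2 * i + 1 \<le> 2 * n" using i by simp
    have "{1..2 * i + 1} \<subseteq> set (take (2 * i + 1) \<pi>) - {\<pi> ! p}"
    proof
      fix x assume x: "x \<in> {1..2 * i + 1}"
      then have "x \<in> set \<pi>" unfolding set(1) using i by simp
      then obtain q where q: "q < 2 * n" "x = \<pi> ! q" unfolding in_set_conv_nth len by blast
      have "x \<le> \<pi> ! (2 * i)" using x large[OF i] by simp
      then have "q < 2 * i + 1" using no321[OF p _ q(1) less] q(2) by (cases "2 * i < q") auto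
      then have "x \<in> set (take (2 * i + 1) \<pi>)" unfolding take_nth[OF len_le] using q(2) by blast
      moreover have "x \<noteq> \<pi> ! p" using \<open>x \<le> \<pi> ! (2 * i)\<close> less by simp
      ultimately show "x \<in> set (take (2 * i + 1) \<pi>) - {\<pi> ! p}" by blast
    qed
    then have "card {1..2 * i + 1} \<le> card (set (take (2 * i + 1) \<pi>) - {\<pi> ! p})" by (intro card_mono) simp_all
    also have "\<dots> < card (set (take (2 * i + 1) \<pi>))"
    proof (rule card_Diff1_less)
      have "p < 2 * i + 1" using p by simp
      then show "\<pi> ! p \<in> set (take (2 * i + 1) \<pi>)" unfolding take_nth[OF len_le] by blast
    qed simp
    finally show False unfolding card_take[OF len_le] by simp
  qed
  have drop: "\<pi> ! Suc (2 * i) < \<pi> ! (2 * i)" if i: "i < n" for i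
  proof -
    obtain p where p: "p < Suc (2 * i)" "\<pi> ! Suc (2 * i) < \<pi> ! p" using not_record[OF i] by blast
    then show ?thesis using is_record[OF i, of p] by (cases "p = 2 * i") simp_all
  qed
  define ds us where "ds = map (\<lambda>i. \<pi> ! (2 * i)) [0..<n]" and "us = map (\<lambda>i. \<pi> ! Suc (2 * i)) [0..<n]"
  have len_du: "length ds = n" "length us = n" by (simp_all add: ds_def us_def)
  have \<pi>_eq: "interleave ds us = \<pi>"
  proof (rule nth_equalityI)
    show "length (interleave ds us) = length \<pi>" by (simp add: length_interleave len_du len)
    fix i assume "i < length (interleave ds us)"
    then have "i < 2 * n" by (simp add: length_interleave len_du)
    then have "i div 2 < n" by simp
    then have "interleave ds us ! (2 * (i div 2)) = \<pi> ! (2 * (i div 2))"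
      "interleave ds us ! Suc (2 * (i div 2)) = \<pi> ! Suc (2 * (i div 2))"
      using nth_interleave[of ds us "i div 2"] len_du by (simp_all add: ds_def us_def)
    then show "interleave ds us ! i = \<pi> ! i"
      by (cases "even i") (simp_all add: odd_two_times_div_two_succ)
  qed
  have sorted_ds: "sorted_wrt (<) ds"
    unfolding sorted_wrt_iff_nth_less len_du using is_record by (simp add: ds_def)
  \<comment> \<open>These entries have a larger one before them, so by \<open>no321\<close>
    everything after them is larger.\<close>
  have "\<pi> ! Suc (2 * i) < \<pi> ! Suc (2 * j)" if "i < j" "j < n" for i j
  proof -
    have "i < n" using that by simp
    from not_record[OF this] obtain p where "p < Suc (2 * i)" "\<pi> ! Suc (2 * i) < \<pi> ! p" by blast
    then show ?thesis using no321[of p "Suc (2 * i)" "Suc (2 * j)"] that by simp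
  qed
  then have sorted_us: "sorted_wrt (<) us"
    unfolding sorted_wrt_iff_nth_less len_du by (simp add: us_def)
  \<comment> \<open>A record that exceeds its successor too is the maximum of the first
    \<open>2 * i + 2\<close> distinct entries.\<close>
  have ds_ge: "2 * i + 2 \<le> ds ! i" if i: "i < n" for i
  proof -
    have "set (take (2 * i + 2) \<pi>) \<subseteq> {1..\<pi> ! (2 * i)}"
    proof
      fix x assume x: "x \<in> set (take (2 * i + 2) \<pi>)"
      have "2 * i + 2 \<le> 2 * n" using i by simp
      from x[unfolded take_nth[OF this]] obtain p where p: "p < 2 * i + 2" "x = \<pi> ! p" by blast
      then consider "p < 2 * i" | "p = 2 * i" | "p = Suc (2 * i)" by linarith
      then have "x \<le> \<pi> ! (2 * i)" using p is_record[OF i, of p] drop[OF i] by cases auto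
      moreover have "x \<in> {1..2 * n}" using in_set_takeD[OF x] unfolding set(1) .
      ultimately show "x \<in> {1..\<pi> ! (2 * i)}" by simp
    qed
    then have "card (set (take (2 * i + 2) \<pi>)) \<le> card {1..\<pi> ! (2 * i)}" by (intro card_mono) simp
    then show ?thesis using card_take[of "2 * i + 2"] i by (simp add: ds_def)
  qed
  have union: "set ds \<union> set us = {1..2 * n}" and disj: "set ds \<inter> set us = {}"
    using set set_interleave[of ds us] distinct_interleave[of ds us] len_du unfolding \<pi>_eq by simp_all
  have ds_range: "1 \<le> x \<and> x \<le> 2 * n" if "x \<in> set ds" for x
    using that UnI1[of x "set ds" "set us"] unfolding union by simp
  have us_iff: "x \<in> set us \<longleftrightarrow> 1 \<le> x \<and> x \<le> 2 * n \<and> x \<notin> set ds" for x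
  proof -
    have "x \<in> set us \<longleftrightarrow> x \<in> set ds \<union> set us \<and> x \<notin> set ds" using disj by blast
    then show ?thesis unfolding union by simp
  qed
  \<comment> \<open>Letter index \<open>k\<close> stands for the value \<open>Suc k\<close>, and
    records become \<open>Down\<close>.\<close>
  define w where "w = map (\<lambda>k. if Suc k \<in> set ds then Down else Up) [0..<2 * n]"
  have lw: "length w = 2 * n" by (simp add: w_def)
  have w_nth: "w ! (x - 1) = (if x \<in> set ds then Down else Up)" if "1 \<le> x" "x \<le> 2 * n" for x
    using that by (cases x) (simp_all add: w_def)
  have "x \<in> set (step_positions Down 0 w) \<longleftrightarrow> x \<in> set ds" for x
    using ds_range[of x] w_nth[of x] by (auto simp: set_step_positions lw split: if_splits)
  then have "set (step_positions Down 0 w) = set ds" by blast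
  then have Down: "step_positions Down 0 w = ds"
    by (intro strict_sorted_equal sorted_step_positions sorted_ds)
  have "x \<in> set (step_positions Up 0 w) \<longleftrightarrow> x \<in> set us" for x
    using us_iff[of x] w_nth[of x] by (auto simp: set_step_positions lw split: if_splits)
  then have "set (step_positions Up 0 w) = set us" by blast
  then have Up: "step_positions Up 0 w = us"
    by (intro strict_sorted_equal sorted_step_positions sorted_us)
  \<comment> \<open>A prefix of length \<open>k\<close> below the axis contains \<open>c\<close>
    Downs with \<open>k < 2 * c\<close>. The last of them sits at a position at most
    \<open>k\<close>, contrary to \<open>ds_ge\<close> at index \<open>c - 1\<close>.\<close>
  have "height (take k w) \<ge> 0" if k: "k \<le> 2 * n" for k
  proof (rule ccontr)
    assume neg: "\<not> ?thesis"
    define c where "c = length (step_positions Down 0 (take k w))"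
    have "length (take k w) = k" using lw k by simp
    then have c: "k < 2 * c" using length_step_positions[of 0 "take k w"] neg by (simp add: c_def)
    have ds_eq: "ds = step_positions Down 0 (take k w) @ step_positions Down (length (take k w)) (drop k w)"
      using step_positions_append[of Down 0 "take k w" "drop k w"] Down by simp
    have "c - 1 < c" using c by simp
    then have nth: "ds ! (c - 1) = step_positions Down 0 (take k w) ! (c - 1)"
      by (subst ds_eq) (simp add: c_def nth_append)
    have "c \<le> n" using arg_cong[OF ds_eq, of length] len_du(1) by (simp add: c_def)
    then have "c - 1 < n" using \<open>c - 1 < c\<close> by simp
    have "ds ! (c - 1) \<in> set (step_positions Down 0 (take k w))"
      unfolding nth using \<open>c - 1 < c\<close> by (simp add: c_def)
    then have "ds ! (c - 1) \<le> k" using \<open>length (take k w) = k\<close> by (simp add: set_step_positions)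
    then show False using ds_ge[OF \<open>c - 1 < n\<close>] c by simp
  qed
  moreover have "height w = 0"
    using length_step_positions(2)[of 0 w] len_du unfolding Up Down by simp
  ultimately have "w \<in> dyck_paths n" using lw by (simp add: dyck_paths_def)
  moreover have "dumont321 w = \<pi>" unfolding dumont321_def Up Down by (rule \<pi>_eq)
  ultimately show ?thesis by (rule that)
qed

lemma dumont321_image: "dumont321 ` dyck_paths n = dumont2_avoiders n [3, 2, 1]"
proof (intro equalityI subsetI)
  fix \<pi> assume "\<pi> \<in> dumont2_avoiders n [3, 2, 1]"
  then obtain w where "w \<in> dyck_paths n" "dumont321 w = \<pi>" by (rule dumont321_surj)
  then show "\<pi> \<in> dumont321 ` dyck_paths n" by blast
qed (use dumont321_avoider in blast)

section \<open>The three bijections\<close>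

lemma avoiders_231: "rev ` avoiders n [1, 3, 2] = avoiders n [2, 3, 1]"
proof (intro equalityI subsetI)
  fix xs assume "xs \<in> avoiders n [2, 3, 1]"
  then have "rev xs \<in> avoiders n [1, 3, 2]"
    unfolding avoiders_def contains_231 permutations_of_set_def by simp
  then have "rev (rev xs) \<in> rev ` avoiders n [1, 3, 2]" by (rule imageI)
  then show "xs \<in> rev ` avoiders n [1, 3, 2]" by simp
next
  fix xs assume "xs \<in> rev ` avoiders n [1, 3, 2]"
  then show "xs \<in> avoiders n [2, 3, 1]"
    unfolding avoiders_def contains_231 permutations_of_set_def by auto
qed

theorem mainTheorem7:
  fixes n :: nat
  assumes "n \<ge> 1"
  shows "(bij_betw f1 (dumont1_avoiders n [1, 3, 2]) (avoiders n [1, 3, 2]) \<and>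
          bij_betw (phi \<circ> f1) (dumont1_avoiders n [1, 3, 2]) (dyck_paths n)) \<and>
         (bij_betw f2 (dumont1_avoiders n [2, 3, 1]) (avoiders n [2, 3, 1]) \<and>
          bij_betw (phi_R \<circ> f2) (dumont1_avoiders n [2, 3, 1]) (dyck_paths n)) \<and>
         bij_betw (\<lambda>\<pi>. replace_udd (psi \<pi>)) (dumont2_avoiders n [3, 2, 1]) (dyck_paths n)"
proof -
  let ?T = "{t. size t = n}"
  \<comment> \<open>Injectivity comes from \<open>dyck_word\<close>, which factors through
    \<open>perm132\<close> by \<open>phi_perm132\<close>.\<close>
  have "inj_on perm132 ?T"
    using bij_betw_dyck_word[of n] unfolding bij_betw_def inj_on_def by (metis phi_perm132)
  then have perm: "bij_betw perm132 ?T (avoiders n [1, 3, 2])"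
    by (simp only: bij_betw_def perm132_image)
  have "bij_betw rev (avoiders n [1, 3, 2]) (avoiders n [2, 3, 1])"
    by (simp only: bij_betw_def avoiders_231 inj_on_rev)
  with perm have perm_rev: "bij_betw (rev \<circ> perm132) ?T (avoiders n [2, 3, 1])"
    by (rule bij_betw_trans)
  show ?thesis
  proof (intro conjI)
    show "bij_betw f1 (dumont1_avoiders n [1, 3, 2]) (avoiders n [1, 3, 2])"
      by (rule bij_betw_via_parametrization[OF perm dumont132_image f1_dumont132])
    show "bij_betw (phi \<circ> f1) (dumont1_avoiders n [1, 3, 2]) (dyck_paths n)"
      by (rule bij_betw_via_parametrization[OF bij_betw_dyck_word dumont132_image])
         (simp add: f1_dumont132 phi_perm132)
    show "bij_betw f2 (dumont1_avoiders n [2, 3, 1]) (avoiders n [2, 3, 1])"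
      by (rule bij_betw_via_parametrization[OF perm_rev dumont231_image]) (simp add: f2_dumont231)
    show "bij_betw (phi_R \<circ> f2) (dumont1_avoiders n [2, 3, 1]) (dyck_paths n)"
      by (rule bij_betw_via_parametrization[OF bij_betw_dyck_word dumont231_image])
         (simp add: f2_dumont231 phi_R_def phi_perm132)
    \<comment> \<open>Dyck paths take the role of the trees here, with the identity as their own
      parametrization.\<close>
    show "bij_betw (\<lambda>\<pi>. replace_udd (psi \<pi>)) (dumont2_avoiders n [3, 2, 1]) (dyck_paths n)"
      by (rule bij_betw_via_parametrization[OF bij_betw_id dumont321_image])
         (simp add: replace_udd_psi_dumont321)
  qed
qed

end
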